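(* Let $H=W^{1,2}(\mathbb{T}^2)\times L^2(\mathbb{T}^2)$ and let $A$ be the operator on $H$ with domain $D(A)=W^{2,2}(\mathbb{T}^2)\times W^{1,2}(\mathbb{T}^2)$ given by $$A=\begin{pmatrix}0&-1\\-\Delta-M\frac{\partial}{\partial x}&0\end{pmatrix},$$ where $\Delta$ is the Laplacian with domain $D(\Delta)=W^{2,2}(\mathbb{T}^2)$ and $M:L^2(\mathbb{T}^2)\to L^2(\mathbb{T}^2)$ is the multiplication operator $M(h)(x,y)=e^{iy}h(x,y)$. Let $(T_t)_{t\in\mathbb{R}}$ be the $C_0$-group on $H$ generated by $-A$. Then $$\|T_t\|=\mathcal{O}\left(\frac{|t|}{\sqrt{\log(|t|)}}\,e^{|t|/2}\right)\quad\text{as } t\to\pm\infty.$$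
   Context: $\mathbb{T}^2=\mathbb{R}^2/(2\pi\mathbb{Z})^2$ is the two-dimensional torus with coordinates $(x,y)$; all function spaces are complex-valued. $W^{k,2}(\mathbb{T}^2)$ is the $L^2$-based Sobolev space of order $k$ with its standard norm, and $H=W^{1,2}(\mathbb{T}^2)\times L^2(\mathbb{T}^2)$ carries the product Hilbert space norm. The operator acts by $A(u,v)=(-v,\,-\Delta u-M\frac{\partial u}{\partial x})$. It is known that $-A$ generates a $C_0$-group on $H$. *)

theory Defs
  imports "HOL-Analysis.Analysis" "HOL-Library.Landau_Symbols"
begin

section \<open>Complex normed spaces and strongly continuous groups\<close>

class scaleC =
  fixes scaleC :: "complex \<Rightarrow> 'a \<Rightarrow> 'a"  (infixr "*\<^sub>C" 75)

class complex_normed_vector = real_normed_vector + scaleC +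
  assumes scaleC_add_right: "c *\<^sub>C (x + y) = c *\<^sub>C x + c *\<^sub>C y"
    and scaleC_add_left: "(c + d) *\<^sub>C x = c *\<^sub>C x + d *\<^sub>C x"
    and scaleC_scaleC: "c *\<^sub>C d *\<^sub>C x = (c * d) *\<^sub>C x"
    and scaleR_scaleC: "r *\<^sub>R x = of_real r *\<^sub>C x"
    and norm_scaleC: "norm (c *\<^sub>C x) = cmod c * norm x"

instantiation prod :: (complex_normed_vector, complex_normed_vector) complex_normed_vector
begin

definition scaleC_prod :: "complex \<Rightarrow> 'a \<times> 'b \<Rightarrow> 'a \<times> 'b" where
  "scaleC_prod c x = (c *\<^sub>C fst x, c *\<^sub>C snd x)"

instance
proof
  fix c d :: complex and r :: real and x y :: "'a \<times> 'b"
  show "c *\<^sub>C (x + y) = c *\<^sub>C x + c *\<^sub>C y"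
    and "(c + d) *\<^sub>C x = c *\<^sub>C x + d *\<^sub>C x"
    and "c *\<^sub>C d *\<^sub>C x = (c * d) *\<^sub>C x"
    and "r *\<^sub>R x = of_real r *\<^sub>C x"
    by (simp_all add: scaleC_prod_def prod_eq_iff scaleC_add_right scaleC_add_left
        scaleC_scaleC scaleR_scaleC)
  show "norm (c *\<^sub>C x) = cmod c * norm x"
    by (simp add: scaleC_prod_def norm_prod_def norm_scaleC power_mult_distrib
        real_sqrt_mult flip: distrib_left)
qed

end

text \<open>
  A \<open>blinfun\<close> is only real-linear, so complex linearity is a separate clause. The operator norm
  of a complex-linear map is the same over both scalar fields.
\<close>

definition C0_group :: "(real \<Rightarrow> 'a::complex_normed_vector \<Rightarrow>\<^sub>L 'a) \<Rightarrow> bool" where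
  "C0_group T \<longleftrightarrow>
     (\<forall>t c x. T t (c *\<^sub>C x) = c *\<^sub>C T t x) \<and>
     T 0 = id_blinfun \<and>
     (\<forall>s t. T (s + t) = T s o\<^sub>L T t) \<and>
     (\<forall>x. continuous_on UNIV (\<lambda>t. T t x))"

text \<open>Unbounded operators, such as the generator, are represented by their graphs.\<close>

definition generator :: "(real \<Rightarrow> 'a::complex_normed_vector \<Rightarrow>\<^sub>L 'a) \<Rightarrow> ('a \<times> 'a) set" where
  "generator T = {(x, y). ((\<lambda>t. (T t x - x) /\<^sub>R t) \<longlongrightarrow> y) (at 0)}"


section \<open>Square-integrable functions on the torus\<close>

text \<open>
  Functions on the torus are functions on the plane that are \<open>2 * pi\<close>-periodic in both variables,
  and integration over the torus is integration over a fundamental domain.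
\<close>

abbreviation torus_square :: "(real \<times> real) set" where
  "torus_square \<equiv> {0..<2 * pi} \<times> {0..<2 * pi}"

definition torus :: "(real \<times> real) measure" where
  "torus = restrict_space lborel torus_square"

definition biperiodic :: "(real \<times> real \<Rightarrow> complex) \<Rightarrow> bool" where
  "biperiodic f \<longleftrightarrow> (\<forall>x y. f (x + 2 * pi, y) = f (x, y) \<and> f (x, y + 2 * pi) = f (x, y))"

definition sq_integrable :: "(real \<times> real \<Rightarrow> complex) \<Rightarrow> bool" where
  "sq_integrable f \<longleftrightarrow>
     f \<in> borel_measurable borel \<and> biperiodic f \<and> integrable torus (\<lambda>z. (cmod (f z))\<^sup>2)"

lemma torus_square_borel [measurable, simp]: "torus_square \<in> sets borel"
  using borel_Times[of "{0..<2*pi}" "{0..<2*pi}"] by simp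

lemma space_torus [simp]: "space torus = torus_square"
  by (simp add: torus_def space_restrict_space)

lemma measurable_torus: "f \<in> borel_measurable borel \<Longrightarrow> f \<in> borel_measurable torus"
  unfolding torus_def by (intro measurable_restrict_space1) simp

lemma finite_measure_torus: "finite_measure torus"
proof
  have "emeasure torus (space torus) = emeasure lborel torus_square"
    by (simp add: torus_def space_restrict_space emeasure_restrict_space)
  also have "\<dots> \<le> emeasure lborel (cbox (0, 0) (2*pi, 2*pi))"
    by (rule emeasure_mono, force simp: cbox_Pair_eq, simp)
  also have "\<dots> < \<infinity>"
    by (rule emeasure_lborel_cbox_finite)
  finally show "emeasure torus (space torus) \<noteq> \<infinity>" by simp
qed

lemma sq_integrable_0: "sq_integrable (\<lambda>_. 0)"
  by (simp add: sq_integrable_def biperiodic_def)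

lemma sq_integrable_cmult:
  assumes "sq_integrable f" shows "sq_integrable (\<lambda>z. c * f z)"
  using assms by (auto simp: sq_integrable_def biperiodic_def norm_mult power_mult_distrib)

lemma sq_integrable_add:
  assumes "sq_integrable f" "sq_integrable g" shows "sq_integrable (\<lambda>z. f z + g z)"
proof -
  have [measurable]: "f \<in> borel_measurable torus" "g \<in> borel_measurable torus"
    using assms by (auto simp: sq_integrable_def measurable_torus)
  have "integrable torus (\<lambda>z. (cmod (f z + g z))\<^sup>2)"
  proof (rule Bochner_Integration.integrable_bound)
    show "integrable torus (\<lambda>z. 2 * (cmod (f z))\<^sup>2 + 2 * (cmod (g z))\<^sup>2)"
      using assms by (auto simp: sq_integrable_def)
    have "(cmod (f z + g z))\<^sup>2 \<le> 2 * (cmod (f z))\<^sup>2 + 2 * (cmod (g z))\<^sup>2" for z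
    proof -
      have "(cmod (f z + g z))\<^sup>2 \<le> (cmod (f z) + cmod (g z))\<^sup>2"
        by (intro power_mono norm_triangle_ineq) auto
      also have "\<dots> \<le> 2 * (cmod (f z))\<^sup>2 + 2 * (cmod (g z))\<^sup>2"
        using sum_squares_bound[of "cmod (f z)" "cmod (g z)"] by (simp add: power2_sum)
      finally show ?thesis .
    qed
    then show "AE z in torus. norm ((cmod (f z + g z))\<^sup>2)
        \<le> norm (2 * (cmod (f z))\<^sup>2 + 2 * (cmod (g z))\<^sup>2)"
      by auto
  qed measurable
  then show ?thesis
    using assms by (auto simp: sq_integrable_def biperiodic_def)
qed

lemma integrable_sq_mult:
  fixes f g :: "real \<times> real \<Rightarrow> 'a::{real_normed_field, second_countable_topology, banach}"
  assumes [measurable]: "f \<in> borel_measurable torus" "g \<in> borel_measurable torus"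
    and "integrable torus (\<lambda>z. (norm (f z))\<^sup>2)" "integrable torus (\<lambda>z. (norm (g z))\<^sup>2)"
  shows "integrable torus (\<lambda>z. f z * g z)"
proof (rule Bochner_Integration.integrable_bound)
  show "integrable torus (\<lambda>z. (norm (f z))\<^sup>2 + (norm (g z))\<^sup>2)"
    using assms by auto
  have "norm (f z * g z) \<le> (norm (f z))\<^sup>2 + (norm (g z))\<^sup>2" for z
  proof -
    have "0 \<le> norm (f z) * norm (g z)" by simp
    then show ?thesis
      using sum_squares_bound[of "norm (f z)" "norm (g z)"] unfolding norm_mult by linarith
  qed
  then show "AE z in torus. norm (f z * g z) \<le> norm ((norm (f z))\<^sup>2 + (norm (g z))\<^sup>2)"
    by auto
qed measurable

lemma sq_integrable_Re_cnj:
  assumes "sq_integrable f" "sq_integrable g"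
  shows "integrable torus (\<lambda>z. Re (f z * cnj (g z)))"
proof -
  have [measurable]: "f \<in> borel_measurable torus" "g \<in> borel_measurable torus"
    using assms by (auto simp: sq_integrable_def measurable_torus)
  have "(\<lambda>z. cnj (g z)) \<in> borel_measurable torus"
    by (rule measurable_compose[of g torus borel]) (auto intro!: borel_measurable_continuous_onI continuous_intros)
  then have "integrable torus (\<lambda>z. f z * cnj (g z))"
    using assms by (intro integrable_sq_mult) (auto simp: sq_integrable_def)
  then show ?thesis by (rule integrable_Re)
qed

lemma sq_integrable_integrable:
  assumes "sq_integrable f" shows "integrable torus f"
proof -
  interpret finite_measure torus by (rule finite_measure_torus)
  have "integrable torus (\<lambda>z. f z * 1)"
  proof (rule integrable_sq_mult)
    show "f \<in> borel_measurable torus" "integrable torus (\<lambda>z. (norm (f z))\<^sup>2)"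
      using assms by (auto simp: sq_integrable_def intro: measurable_torus)
  qed simp_all
  then show ?thesis by simp
qed

definition torus_rel :: "(real \<times> real \<Rightarrow> complex) \<Rightarrow> (real \<times> real \<Rightarrow> complex) \<Rightarrow> bool" where
  "torus_rel f g \<longleftrightarrow> sq_integrable f \<and> sq_integrable g \<and> (AE z in torus. f z = g z)"

lemma part_equivp_torus_rel: "part_equivp torus_rel"
proof (rule part_equivpI)
  show "\<exists>f. torus_rel f f"
    using sq_integrable_0 by (auto simp: torus_rel_def)
  show "symp torus_rel"
    by (auto simp: symp_def torus_rel_def)
  show "transp torus_rel"
    unfolding transp_def torus_rel_def by (auto elim: AE_mp)
qed

quotient_type torus_L2 = "real \<times> real \<Rightarrow> complex" / partial: torus_rel
  by (rule part_equivp_torus_rel)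

lemma torus_relD:
  assumes "torus_rel f g"
  shows "f \<in> borel_measurable torus" "g \<in> borel_measurable torus" "AE z in torus. f z = g z"
  using assms by (auto simp: torus_rel_def sq_integrable_def measurable_torus)

lemma torus_rel_refl: "torus_rel f f \<longleftrightarrow> sq_integrable f"
  by (auto simp: torus_rel_def)

instantiation torus_L2 :: real_vector
begin

lift_definition zero_torus_L2 :: torus_L2 is "\<lambda>_. 0"
  by (simp add: torus_rel_refl sq_integrable_0)

lift_definition plus_torus_L2 :: "torus_L2 \<Rightarrow> torus_L2 \<Rightarrow> torus_L2" is "\<lambda>f g z. f z + g z"
  by (auto simp: torus_rel_def sq_integrable_add)

lift_definition uminus_torus_L2 :: "torus_L2 \<Rightarrow> torus_L2" is "\<lambda>f z. - f z"
  using sq_integrable_cmult[of _ "-1"] by (auto simp: torus_rel_def)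

definition minus_torus_L2 :: "torus_L2 \<Rightarrow> torus_L2 \<Rightarrow> torus_L2" where
  "minus_torus_L2 u w = u + (- w)"

lift_definition scaleR_torus_L2 :: "real \<Rightarrow> torus_L2 \<Rightarrow> torus_L2" is "\<lambda>r f z. of_real r * f z"
  by (auto simp: torus_rel_def sq_integrable_cmult)

instance
proof
  fix u v w :: torus_L2 and r s :: real
  show "u + v + w = u + (v + w)"
    by transfer (auto simp: torus_rel_def sq_integrable_add algebra_simps)
  show "u + v = v + u"
    by transfer (auto simp: torus_rel_def sq_integrable_add algebra_simps)
  show "0 + u = u"
    by transfer auto
  show "- u + u = 0"
    by transfer (simp add: torus_rel_refl sq_integrable_0)
  show "u - v = u + - v"
    by (simp add: minus_torus_L2_def)
  show "r *\<^sub>R (u + v) = r *\<^sub>R u + r *\<^sub>R v"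
    by transfer (auto simp: torus_rel_def sq_integrable_add sq_integrable_cmult distrib_left)
  show "(r + s) *\<^sub>R u = r *\<^sub>R u + s *\<^sub>R u"
    by transfer (auto simp: torus_rel_def sq_integrable_add sq_integrable_cmult distrib_right)
  show "r *\<^sub>R s *\<^sub>R u = (r * s) *\<^sub>R u"
    by transfer (auto simp: torus_rel_def sq_integrable_cmult mult.assoc)
  show "1 *\<^sub>R u = u"
    by transfer auto
qed

end

text \<open>
  The class \<open>real_inner\<close> asks for the real part of the complex inner product, which induces the
  same norm.
\<close>

instantiation torus_L2 :: real_inner
begin

lift_definition inner_torus_L2 :: "torus_L2 \<Rightarrow> torus_L2 \<Rightarrow> real"
  is "\<lambda>f g. \<integral>z. Re (f z * cnj (g z)) \<partial>torus"
proof (rule integral_cong_AE)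
  fix f f' g g' assume "torus_rel f f'" "torus_rel g g'"
  note rel = torus_relD[OF this(1)] torus_relD[OF this(2)]
  note [measurable] = rel(1,2,4,5)
  show "(\<lambda>z. Re (f z * cnj (g z))) \<in> borel_measurable torus"
    by simp
  show "(\<lambda>z. Re (f' z * cnj (g' z))) \<in> borel_measurable torus"
    by simp
  show "AE z in torus. Re (f z * cnj (g z)) = Re (f' z * cnj (g' z))"
    using rel(3,6) by eventually_elim simp
qed

lift_definition norm_torus_L2 :: "torus_L2 \<Rightarrow> real"
  is "\<lambda>f. sqrt (\<integral>z. (cmod (f z))\<^sup>2 \<partial>torus)"
  by (rule arg_cong[where f = sqrt], rule integral_cong_AE) (auto dest: torus_relD)

definition dist_torus_L2 :: "torus_L2 \<Rightarrow> torus_L2 \<Rightarrow> real" where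
  "dist_torus_L2 u w = norm (u - w)"

definition sgn_torus_L2 :: "torus_L2 \<Rightarrow> torus_L2" where
  "sgn_torus_L2 u = u /\<^sub>R norm u"

definition uniformity_torus_L2 :: "(torus_L2 \<times> torus_L2) filter" where
  "uniformity_torus_L2 = (INF e\<in>{0<..}. principal {(u, w). dist u w < e})"

definition open_torus_L2 :: "torus_L2 set \<Rightarrow> bool" where
  "open_torus_L2 U \<longleftrightarrow> (\<forall>x\<in>U. \<forall>\<^sub>F (x', y) in uniformity. x' = x \<longrightarrow> y \<in> U)"

instance
proof
  fix u v w :: torus_L2 and r :: real and U :: "torus_L2 set"
  show "sgn u = u /\<^sub>R norm u"
    by (rule sgn_torus_L2_def)
  show "dist u w = norm (u - w)"
    by (rule dist_torus_L2_def)
  show "uniformity = (INF e\<in>{0<..}. principal {(x, y :: torus_L2). dist x y < e})"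
    by (rule uniformity_torus_L2_def)
  show "open U \<longleftrightarrow> (\<forall>x\<in>U. \<forall>\<^sub>F (x', y) in uniformity. x' = x \<longrightarrow> y \<in> U)"
    by (rule open_torus_L2_def)
  show "inner u w = inner w u"
    by transfer (simp add: algebra_simps)
  show "inner (u + v) w = inner u w + inner v w"
  proof transfer
    fix f g h assume "torus_rel f f" "torus_rel g g" "torus_rel h h"
    then have "integrable torus (\<lambda>z. Re (f z * cnj (h z)))"
        "integrable torus (\<lambda>z. Re (g z * cnj (h z)))"
      by (auto simp: torus_rel_refl intro!: sq_integrable_Re_cnj simp del: times_complex.sel)
    from Bochner_Integration.integral_add[OF this]
    show "(\<integral>z. Re ((f z + g z) * cnj (h z)) \<partial>torus) =
        (\<integral>z. Re (f z * cnj (h z)) \<partial>torus) + (\<integral>z. Re (g z * cnj (h z)) \<partial>torus)"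
      by (simp add: algebra_simps)
  qed
  show "inner (r *\<^sub>R u) w = r * inner u w"
    by transfer (simp add: mult.assoc flip: integral_mult_right_zero right_diff_distrib distrib_left)
  have sq: "Re (c * cnj c) = (cmod c)\<^sup>2" for c
    unfolding cmod_power2 by (simp add: power2_eq_square)
  show "0 \<le> inner u u"
    by transfer (simp only: sq, simp)
  show "inner u u = 0 \<longleftrightarrow> u = 0"
  proof transfer
    fix f assume "torus_rel f f"
    then have f: "sq_integrable f" by (simp add: torus_rel_refl)
    then show "((\<integral>z. Re (f z * cnj (f z)) \<partial>torus) = 0) = torus_rel f (\<lambda>_. 0)"
      unfolding sq
      by (subst integral_nonneg_eq_0_iff_AE)
        (auto simp: torus_rel_def sq_integrable_0, auto simp: sq_integrable_def)
  qed
  show "norm u = sqrt (inner u u)"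
    by transfer (simp only: sq)
qed

end

instantiation torus_L2 :: complex_normed_vector
begin

lift_definition scaleC_torus_L2 :: "complex \<Rightarrow> torus_L2 \<Rightarrow> torus_L2" is "\<lambda>c f z. c * f z"
  by (auto simp: torus_rel_def sq_integrable_cmult)

instance
proof
  fix u w :: torus_L2 and r :: real and c d :: complex
  show "c *\<^sub>C (u + w) = c *\<^sub>C u + c *\<^sub>C w"
    by transfer (auto simp: torus_rel_def sq_integrable_add sq_integrable_cmult distrib_left)
  show "(c + d) *\<^sub>C u = c *\<^sub>C u + d *\<^sub>C u"
    by transfer (auto simp: torus_rel_def sq_integrable_add sq_integrable_cmult distrib_right)
  show "c *\<^sub>C d *\<^sub>C u = (c * d) *\<^sub>C u"
    by transfer (auto simp: torus_rel_def sq_integrable_cmult mult.assoc)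
  show "r *\<^sub>R u = of_real r *\<^sub>C u"
    by transfer (auto simp: torus_rel_def sq_integrable_cmult)
  show "norm (c *\<^sub>C u) = cmod c * norm u"
    by transfer (simp add: norm_mult power_mult_distrib real_sqrt_mult)
qed

end


section \<open>Weak derivatives\<close>

definition has_partials ::
  "(real \<times> real \<Rightarrow> complex) \<Rightarrow> (real \<times> real \<Rightarrow> complex) \<Rightarrow> (real \<times> real \<Rightarrow> complex) \<Rightarrow> bool"
  where "has_partials f fx fy \<longleftrightarrow>
    (\<forall>z. (f has_derivative (\<lambda>h. fst h *\<^sub>R fx z + snd h *\<^sub>R fy z)) (at z))"

primrec Ck :: "nat \<Rightarrow> (real \<times> real \<Rightarrow> complex) \<Rightarrow> bool" where
  "Ck 0 f \<longleftrightarrow> continuous_on UNIV f"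
| "Ck (Suc k) f \<longleftrightarrow> (\<exists>fx fy. has_partials f fx fy \<and> Ck k fx \<and> Ck k fy)"

definition torus_test :: "(real \<times> real \<Rightarrow> complex) set" where
  "torus_test = {f. biperiodic f \<and> (\<forall>k. Ck k f)}"

definition partial_x :: "(real \<times> real \<Rightarrow> complex) \<Rightarrow> real \<times> real \<Rightarrow> complex" where
  "partial_x f = (\<lambda>(x, y). vector_derivative (\<lambda>s. f (s, y)) (at x))"

definition partial_y :: "(real \<times> real \<Rightarrow> complex) \<Rightarrow> real \<times> real \<Rightarrow> complex" where
  "partial_y f = (\<lambda>(x, y). vector_derivative (\<lambda>s. f (x, s)) (at y))"

lemma dx_dy_eqI:
  assumes "has_partials f fx fy"
  shows "partial_x f = fx" "partial_y f = fy"
proof -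
  show "partial_x f = fx"
  proof
    fix z :: "real \<times> real" obtain x y where z: "z = (x, y)" by fastforce
    have "((\<lambda>s. (s, y)) has_derivative (\<lambda>h. (h, 0))) (at x)"
      by (auto intro!: derivative_eq_intros)
    from has_derivative_compose[OF this assms[unfolded has_partials_def, rule_format]]
    have "((\<lambda>s. f (s, y)) has_vector_derivative fx z) (at x)"
      by (simp add: has_vector_derivative_def z)
    then show "partial_x f z = fx z"
      by (simp add: partial_x_def z vector_derivative_at)
  qed
  show "partial_y f = fy"
  proof
    fix z :: "real \<times> real" obtain x y where z: "z = (x, y)" by fastforce
    have "((\<lambda>s. (x, s)) has_derivative (\<lambda>h. (0, h))) (at y)"
      by (auto intro!: derivative_eq_intros)
    from has_derivative_compose[OF this assms[unfolded has_partials_def, rule_format]]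
    have "((\<lambda>s. f (x, s)) has_vector_derivative fy z) (at y)"
      by (simp add: has_vector_derivative_def z)
    then show "partial_y f z = fy z"
      by (simp add: partial_y_def z vector_derivative_at)
  qed
qed

lemma Ck_continuous: "Ck k f \<Longrightarrow> continuous_on UNIV f"
proof (cases k)
  case (Suc n)
  assume "Ck k f"
  then obtain fx fy where "has_partials f fx fy"
    unfolding Suc by auto
  then have *: "(f has_derivative (\<lambda>h. fst h *\<^sub>R fx z + snd h *\<^sub>R fy z)) (at z)" for z
    unfolding has_partials_def by (rule spec)
  show ?thesis
    by (intro continuous_at_imp_continuous_on ballI has_derivative_continuous[OF *])
qed simp

lemma Ck_Suc_imp: "Ck (Suc k) f \<Longrightarrow> Ck k f"
proof (induction k arbitrary: f)
  case 0 then show ?case using Ck_continuous[of "Suc 0" f] by (simp only: Ck.simps(1))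
next
  case (Suc k)
  then show ?case unfolding Ck.simps(2)[of "Suc k"] Ck.simps(2)[of k] by blast
qed

lemma Ck_const: "Ck k (\<lambda>_. c)"
proof (induction k arbitrary: c)
  case (Suc k)
  have "has_partials (\<lambda>_. c) (\<lambda>_. 0) (\<lambda>_. 0)"
    by (simp add: has_partials_def)
  then show ?case using Suc[of 0] by auto
qed simp

lemma Ck_add: "Ck k f \<Longrightarrow> Ck k g \<Longrightarrow> Ck k (\<lambda>z. f z + g z)"
proof (induction k arbitrary: f g)
  case 0 then show ?case by (auto intro: continuous_on_add)
next
  case (Suc k)
  from Suc.prems obtain fx fy gx gy where
    *: "has_partials f fx fy" "Ck k fx" "Ck k fy" "has_partials g gx gy" "Ck k gx" "Ck k gy"
    by auto
  have "has_partials (\<lambda>z. f z + g z) (\<lambda>z. fx z + gx z) (\<lambda>z. fy z + gy z)"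
    unfolding has_partials_def
  proof
    fix z
    show "((\<lambda>z. f z + g z) has_derivative
        (\<lambda>h. fst h *\<^sub>R (fx z + gx z) + snd h *\<^sub>R (fy z + gy z))) (at z)"
      using has_derivative_add[OF *(1)[unfolded has_partials_def, rule_format]
          *(4)[unfolded has_partials_def, rule_format], of z]
      by (simp add: algebra_simps)
  qed
  then show ?case
    using Suc.IH[OF *(2,5)] Suc.IH[OF *(3,6)] by auto
qed

lemma Ck_mult: "Ck k f \<Longrightarrow> Ck k g \<Longrightarrow> Ck k (\<lambda>z. f z * g z)"
proof (induction k arbitrary: f g)
  case 0 then show ?case by (auto intro: continuous_on_mult)
next
  case (Suc k)
  from Suc.prems obtain fx fy gx gy where
    *: "has_partials f fx fy" "Ck k fx" "Ck k fy" "has_partials g gx gy" "Ck k gx" "Ck k gy"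
    by auto
  have fg: "Ck k f" "Ck k g"
    using Suc.prems Ck_Suc_imp by blast+
  have "has_partials (\<lambda>z. f z * g z) (\<lambda>z. f z * gx z + fx z * g z) (\<lambda>z. f z * gy z + fy z * g z)"
    unfolding has_partials_def
  proof
    fix z
    show "((\<lambda>z. f z * g z) has_derivative
        (\<lambda>h. fst h *\<^sub>R (f z * gx z + fx z * g z) + snd h *\<^sub>R (f z * gy z + fy z * g z))) (at z)"
      using has_derivative_mult[OF *(1)[unfolded has_partials_def, rule_format]
          *(4)[unfolded has_partials_def, rule_format], of z]
      by (simp add: algebra_simps scaleR_conv_of_real)
  qed
  then show ?case
    using Ck_add[OF Suc.IH[OF fg(1) *(5)] Suc.IH[OF *(2) fg(2)]]
      Ck_add[OF Suc.IH[OF fg(1) *(6)] Suc.IH[OF *(3) fg(2)]]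
    by auto
qed

lemma Ck_cos_sin:
  "Ck k (\<lambda>z. of_real (a * cos (fst z) + b * sin (fst z)))"
  "Ck k (\<lambda>z. of_real (a * cos (snd z) + b * sin (snd z)))"
proof (induction k arbitrary: a b)
  case 0
  {
    case 1 show ?case by (auto intro!: continuous_intros)
  next
    case 2 show ?case by (auto intro!: continuous_intros)
  }
next
  case (Suc k)
  {
    case 1
    have "has_partials (\<lambda>z. of_real (a * cos (fst z) + b * sin (fst z)))
        (\<lambda>z. of_real (b * cos (fst z) + (- a) * sin (fst z))) (\<lambda>_. 0)"
      unfolding has_partials_def
      by (auto intro!: derivative_eq_intros simp: scaleR_conv_of_real algebra_simps)
    then show ?case
      using Suc.IH(1)[of b "- a"] Ck_const[of k 0] unfolding Ck.simps by blast
  next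
    case 2
    have "has_partials (\<lambda>z. of_real (a * cos (snd z) + b * sin (snd z)))
        (\<lambda>_. 0) (\<lambda>z. of_real (b * cos (snd z) + (- a) * sin (snd z)))"
      unfolding has_partials_def
      by (auto intro!: derivative_eq_intros simp: scaleR_conv_of_real algebra_simps)
    then show ?case
      using Suc.IH(2)[of b "- a"] Ck_const[of k 0] unfolding Ck.simps by blast
  }
qed

lemma test_dx_dy:
  assumes "f \<in> torus_test" shows "partial_x f \<in> torus_test" "partial_y f \<in> torus_test"
proof -
  have per: "biperiodic f" and Ck: "\<And>k. Ck (Suc k) f"
    using assms by (auto simp: torus_test_def simp del: Ck.simps)
  have "Ck k (partial_x f) \<and> Ck k (partial_y f)" for k
  proof -
    from Ck[of k] obtain fx fy where "has_partials f fx fy" "Ck k fx" "Ck k fy"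
      by auto
    then show ?thesis using dx_dy_eqI by metis
  qed
  moreover have "biperiodic (partial_x f)" "biperiodic (partial_y f)"
  proof -
    have shift: "vector_derivative g (at (s + 2 * pi)) = vector_derivative g (at s)"
      if "\<And>s. g (s + 2 * pi) = g s" for g :: "real \<Rightarrow> complex" and s
    proof -
      have "g (s + 2 * pi + h) = g (s + h)" for h
        using that[of "s + h"] by (simp add: algebra_simps)
      then have "(g has_vector_derivative D) (at (s + 2 * pi)) \<longleftrightarrow>
          (g has_vector_derivative D) (at s)" for D
        unfolding has_vector_derivative_def has_derivative_at by (simp add: that)
      then show ?thesis by (simp add: vector_derivative_def)
    qed
    show "biperiodic (partial_x f)" "biperiodic (partial_y f)"
      using per shift[of "\<lambda>s. f (s, _)"] shift[of "\<lambda>s. f (_, s)"]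
      by (auto simp: biperiodic_def partial_x_def partial_y_def)
  qed
  ultimately show "partial_x f \<in> torus_test" "partial_y f \<in> torus_test"
    by (auto simp: torus_test_def)
qed

lemma test_deriv: "f \<in> torus_test \<Longrightarrow> (partial_x ^^ a) ((partial_y ^^ b) f) \<in> torus_test"
proof -
  assume "f \<in> torus_test"
  then have "(partial_y ^^ b) f \<in> torus_test" by (induction b) (auto intro: test_dx_dy)
  then show ?thesis by (induction a) (auto intro: test_dx_dy)
qed

lemma test_continuous: "f \<in> torus_test \<Longrightarrow> continuous_on UNIV f"
  by (auto simp: torus_test_def intro: Ck_continuous)

lemma test_measurable: "f \<in> torus_test \<Longrightarrow> f \<in> borel_measurable torus"
  by (rule measurable_torus[OF borel_measurable_continuous_onI[OF test_continuous]])

lemma bounded_torus_integrable_mult: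
  fixes f g :: "real \<times> real \<Rightarrow> 'a::{real_normed_field, second_countable_topology, banach}"
  assumes f: "integrable torus f" and g: "continuous_on UNIV g"
  shows "integrable torus (\<lambda>z. f z * g z)"
proof -
  have gm [measurable]: "g \<in> borel_measurable torus"
    by (rule measurable_torus[OF borel_measurable_continuous_onI[OF g]])
  have fm [measurable]: "f \<in> borel_measurable torus" using f by auto
  have "compact (g ` cbox (0, 0) (2 * pi, 2 * pi))"
    by (rule compact_continuous_image[OF continuous_on_subset[OF g subset_UNIV] compact_cbox])
  then have "bounded (g ` cbox (0, 0) (2 * pi, 2 * pi))" by (rule compact_imp_bounded)
  then obtain B where B: "norm (g z) \<le> B" if "z \<in> cbox (0, 0) (2 * pi, 2 * pi)" for z
    unfolding bounded_iff by blast
  show ?thesis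
  proof (rule Bochner_Integration.integrable_bound)
    show "integrable torus (\<lambda>z. B * norm (f z))" using f by auto
    show "AE z in torus. norm (f z * g z) \<le> norm (B * norm (f z))"
    proof (rule AE_I2)
      fix z assume "z \<in> space torus"
      then have "norm (g z) \<le> B" by (intro B) (auto simp: cbox_Pair_eq)
      then have "norm (f z) * norm (g z) \<le> norm (f z) * \<bar>B\<bar>"
        by (intro mult_left_mono) auto
      then show "norm (f z * g z) \<le> norm (B * norm (f z))"
        by (simp add: norm_mult abs_mult mult.commute)
    qed
  qed measurable
qed

lemma integrable_test_mult:
  "sq_integrable f \<Longrightarrow> g \<in> torus_test \<Longrightarrow> integrable torus (\<lambda>z. f z * g z)"
  by (rule bounded_torus_integrable_mult[OF sq_integrable_integrable test_continuous])

text \<open>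
  \<open>has_weak_deriv a b u w\<close> says that \<open>w\<close> is the weak derivative of \<open>u\<close> of order \<open>a\<close> in the first
  and \<open>b\<close> in the second variable.
\<close>

lift_definition has_weak_deriv :: "nat \<Rightarrow> nat \<Rightarrow> torus_L2 \<Rightarrow> torus_L2 \<Rightarrow> bool"
  is "\<lambda>a b u w. \<forall>\<phi>\<in>torus_test.
        (\<integral>z. u z * (partial_x ^^ a) ((partial_y ^^ b) \<phi>) z \<partial>torus) = (- 1) ^ (a + b) * (\<integral>z. w z * \<phi> z \<partial>torus)"
proof -
  have *: "(\<integral>z. u z * \<phi> z \<partial>torus) = (\<integral>z. u' z * \<phi> z \<partial>torus)"
    if "torus_rel u u'" "\<phi> \<in> torus_test" for u u' \<phi>
    using torus_relD[OF that(1)] test_measurable[OF that(2)] by (intro integral_cong_AE) auto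
  fix a b u u' w w' assume "torus_rel u u'" "torus_rel w w'"
  then show "(\<forall>\<phi>\<in>torus_test. (\<integral>z. u z * (partial_x ^^ a) ((partial_y ^^ b) \<phi>) z \<partial>torus) =
               (- 1) ^ (a + b) * (\<integral>z. w z * \<phi> z \<partial>torus)) =
             (\<forall>\<phi>\<in>torus_test. (\<integral>z. u' z * (partial_x ^^ a) ((partial_y ^^ b) \<phi>) z \<partial>torus) =
               (- 1) ^ (a + b) * (\<integral>z. w' z * \<phi> z \<partial>torus))"
    using *[OF _ test_deriv] * by simp
qed

definition weak_deriv :: "nat \<Rightarrow> nat \<Rightarrow> torus_L2 \<Rightarrow> torus_L2" where
  "weak_deriv a b u = (THE w. has_weak_deriv a b u w)"


subsection \<open>Uniqueness of weak derivatives\<close>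

lemma test_real_polynomial:
  assumes "real_polynomial_function p"
  shows "(\<lambda>z. complex_of_real (p (cis (fst z), cis (snd z)))) \<in> torus_test"
proof -
  have "Ck k (\<lambda>z. complex_of_real (p (cis (fst z), cis (snd z))))" for k
    using assms
  proof (induction p)
    case (linear l)
    then interpret bounded_linear l .
    have eq: "l (cis s, cis t) = (l (1, 0) * cos s + l (\<i>, 0) * sin s)
        + (l (0, 1) * cos t + l (0, \<i>) * sin t)" for s t
    proof -
      have "(cis s, cis t) = cos s *\<^sub>R (1, 0) + sin s *\<^sub>R (\<i>, 0)
          + cos t *\<^sub>R (0, 1) + sin t *\<^sub>R (0, \<i>)"
        by (simp add: complex_eq_iff)
      then show ?thesis by (simp add: add scaleR del: scaleR_Pair add_Pair)
    qed
    show ?case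
      using Ck_add[OF Ck_cos_sin(1)[of k "l (1, 0)" "l (\<i>, 0)"]
          Ck_cos_sin(2)[of k "l (0, 1)" "l (0, \<i>)"]]
      by (simp add: eq)
  next
    case (const c) show ?case by (rule Ck_const)
  next
    case (add f g) then show ?case using Ck_add by (simp)
  next
    case (mult f g) then show ?case using Ck_mult by (simp)
  qed
  moreover have "cis (s + 2 * pi) = cis s" for s
    by (simp add: complex_eq_iff)
  ultimately show ?thesis by (auto simp: torus_test_def biperiodic_def)
qed

lemma orthogonal_continuous:
  fixes f :: "real \<times> real \<Rightarrow> real" and F :: "complex \<times> complex \<Rightarrow> real"
  assumes f: "integrable torus f"
    and orth: "\<And>p. real_polynomial_function p \<Longrightarrow>
      (\<integral>z. f z * p (cis (fst z), cis (snd z)) \<partial>torus) = 0"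
    and F: "continuous_on UNIV F"
  shows "(\<integral>z. f z * F (cis (fst z), cis (snd z)) \<partial>torus) = 0" (is "?I = 0")
proof (rule ccontr)
  assume "?I \<noteq> 0"
  define N where "N = (\<integral>z. \<bar>f z\<bar> \<partial>torus)"
  define e where "e = \<bar>?I\<bar> / (2 * (N + 1))"
  have N: "N \<ge> 0" by (simp add: N_def)
  with \<open>?I \<noteq> 0\<close> have "e > 0" by (auto simp: e_def)
  let ?S = "sphere 0 1 \<times> sphere 0 1 :: (complex \<times> complex) set"
  have "compact ?S" by (intro compact_Times compact_sphere)
  then obtain p where p: "real_polynomial_function p" "\<And>x. x \<in> ?S \<Longrightarrow> \<bar>F x - p x\<bar> < e"
    using Stone_Weierstrass_real_polynomial_function[of ?S F e] \<open>e > 0\<close>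
      continuous_on_subset[OF F] by (metis subset_UNIV)
  have cont: "continuous_on UNIV (\<lambda>z::real\<times>real. G (cis (fst z), cis (snd z)))"
    if "continuous_on UNIV G" for G :: "complex \<times> complex \<Rightarrow> real"
    by (rule continuous_on_compose2[OF that]) (auto intro!: continuous_intros)
  have pc: "continuous_on UNIV p" using p(1) continuous_on_polymonial_function real_polynomial_function_eq by blast
  have int: "integrable torus (\<lambda>z. f z * F (cis (fst z), cis (snd z)))"
    "integrable torus (\<lambda>z. f z * p (cis (fst z), cis (snd z)))"
    using F pc by (auto intro!: bounded_torus_integrable_mult f cont)
  let ?D = "\<lambda>z. f z * F (cis (fst z), cis (snd z)) - f z * p (cis (fst z), cis (snd z))"
  have "?I = (\<integral>z. f z * F (cis (fst z), cis (snd z)) - f z * p (cis (fst z), cis (snd z)) \<partial>torus)"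
    using int orth[OF p(1)] by simp
  then have "\<bar>?I\<bar> = norm (\<integral>z. ?D z \<partial>torus)" by simp
  also have "\<dots> \<le> (\<integral>z. e * \<bar>f z\<bar> \<partial>torus)"
  proof (rule Bochner_Integration.integral_norm_bound_integral)
    show "integrable torus (\<lambda>z. f z * F (cis (fst z), cis (snd z)) - f z * p (cis (fst z), cis (snd z)))"
      using int by auto
    show "integrable torus (\<lambda>z. e * \<bar>f z\<bar>)" using f by auto
    fix z
    have "\<bar>f z\<bar> * \<bar>F (cis (fst z), cis (snd z)) - p (cis (fst z), cis (snd z))\<bar> \<le> \<bar>f z\<bar> * e"
      using p(2)[of "(cis (fst z), cis (snd z))"] by (intro mult_left_mono) (auto intro: less_imp_le)
    then show "norm (?D z) \<le> e * \<bar>f z\<bar>"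
      by (simp add: abs_mult mult.commute flip: right_diff_distrib)
  qed
  also have "\<dots> = e * N" by (simp add: N_def)
  also have "\<dots> < \<bar>?I\<bar>"
  proof -
    have "e * N < e * (2 * (N + 1))" using \<open>e > 0\<close> N by simp
    also have "\<dots> = \<bar>?I\<bar>" using N by (simp add: e_def)
    finally show ?thesis .
  qed
  finally show False by simp
qed

definition arc_bump :: "real \<Rightarrow> real \<Rightarrow> nat \<Rightarrow> complex \<Rightarrow> real" where
  "arc_bump l r n c = min 1 (real n * max 0 (Re (c * cis (- (l + r) / 2)) - cos ((r - l) / 2)))"

lemma arc_bump_bounds: "0 \<le> arc_bump l r n c" "arc_bump l r n c \<le> 1"
  by (auto simp: arc_bump_def)

lemma arc_bump_limit:
  assumes "0 \<le> l" "l < r" "r \<le> 2 * pi" "0 \<le> x" "x < 2 * pi"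
  shows "(\<lambda>n. arc_bump l r n (cis x)) \<longlonglongrightarrow> indicator {l<..<r} x"
proof -
  define m where "m = (l + r) / 2"
  define d where "d = (r - l) / 2"
  have md: "l = m - d" "r = m + d" "0 < d" "d \<le> m" "m + d \<le> 2 * pi" "d \<le> pi"
    using assms by (auto simp: m_def d_def field_simps)
  have eq: "arc_bump l r n (cis x) = min 1 (real n * max 0 (cos \<bar>x - m\<bar> - cos d))" for n
  proof -
    have "Re (cis x * cis (- (l + r) / 2)) = cos \<bar>x - m\<bar>"
    proof -
      have "Re (cis x * cis (- (l + r) / 2)) = cos (x - m)"
        unfolding cis_mult by (simp add: m_def diff_divide_distrib add_divide_distrib algebra_simps)
      also have "\<dots> = cos \<bar>x - m\<bar>" by simp
      finally show ?thesis .
    qed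
    then show ?thesis by (simp only: arc_bump_def d_def)
  qed
  show ?thesis
  proof (cases "x \<in> {l<..<r}")
    case True
    then have "cos d < cos \<bar>x - m\<bar>"
      using md by (intro cos_monotone_0_pi) auto
    then have pos: "cos \<bar>x - m\<bar> - cos d > 0" by simp
    obtain N :: nat where "1 < real N * (cos \<bar>x - m\<bar> - cos d)"
      using reals_Archimedean3[OF pos] by blast
    moreover have "real N * (cos \<bar>x - m\<bar> - cos d) \<le> real n * (cos \<bar>x - m\<bar> - cos d)" if "n \<ge> N" for n
      using that pos by (intro mult_right_mono) auto
    ultimately have "\<forall>n\<ge>N. 1 < real n * (cos \<bar>x - m\<bar> - cos d)"
      using less_le_trans by blast
    then have "\<forall>n\<ge>N. arc_bump l r n (cis x) = 1"
      using pos unfolding eq by (simp add: max_absorb2 min_absorb1)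
    then show ?thesis
      using True by (intro tendsto_eventually) (auto simp: eventually_sequentially)
  next
    case False
    have "cos \<bar>x - m\<bar> \<le> cos d"
    proof (cases "\<bar>x - m\<bar> \<le> pi")
      case True
      then show ?thesis using False md by (intro cos_monotone_0_pi_le) auto
    next
      case F: False
      have "cos (2 * pi - \<bar>x - m\<bar>) \<le> cos d"
        using F md assms by (intro cos_monotone_0_pi_le) auto
      then show ?thesis by (simp add: cos_diff)
    qed
    then show ?thesis using False by (simp add: eq)
  qed
qed

lemma AE_torus_interior: "AE z in torus. fst z \<noteq> 0 \<and> snd z \<noteq> 0"
proof -
  have "AE z in lborel. z \<notin> ({0} \<times> UNIV :: (real \<times> real) set)"
       "AE z in lborel. z \<notin> (UNIV \<times> {0} :: (real \<times> real) set)"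
    by (auto intro!: AE_not_in simp: null_sets_def lborel.emeasure_pair_measure_Times
        simp flip: lborel_prod)
  then have "AE z in lborel. (fst z :: real) \<noteq> 0 \<and> (snd z :: real) \<noteq> 0"
    by eventually_elim auto
  then show ?thesis
    unfolding torus_def by (subst AE_restrict_space_iff) auto
qed

lemma orthogonal_imp_zero:
  fixes f :: "real \<times> real \<Rightarrow> real"
  assumes f: "integrable torus f"
    and orth: "\<And>p. real_polynomial_function p \<Longrightarrow>
      (\<integral>z. f z * p (cis (fst z), cis (snd z)) \<partial>torus) = 0"
  shows "AE z in torus. f z = 0"
proof -
  have [measurable]: "f \<in> borel_measurable torus" using f by auto
  have sets_torus: "A \<in> sets torus \<longleftrightarrow> A \<subseteq> torus_square \<and> A \<in> sets borel" for A
    by (auto simp: torus_def sets_restrict_space_iff)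
  have set_int: "set_integrable torus A f" if "A \<in> sets torus" for A
    using that f unfolding set_integrable_def by (intro integrable_mult_indicator)
  define P where "P A \<longleftrightarrow> (LINT z:A \<inter> torus_square|torus. f z) = 0" for A
  have meas: "A \<inter> torus_square \<in> sets torus" if "A \<in> sets borel" for A
    using that by (auto simp: sets_torus)
  have total: "(\<integral>z. f z \<partial>torus) = 0"
    using orth[OF real_polynomial_function.intros(2)[of 1]] by simp
  have box: "P (box p q)" for p q :: "real \<times> real"
  proof -
    define l1 l2 where "l1 = max 0 (fst p)" and "l2 = max 0 (snd p)"
    define r1 r2 where "r1 = min (2*pi) (fst q)" and "r2 = min (2*pi) (snd q)"
    let ?ind = "\<lambda>z. indicator {l1<..<r1} (fst z) * indicator {l2<..<r2} (snd z) :: real"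
    have "open ({l1<..<r1} \<times> {l2<..<r2})"
      by (intro open_Times open_greaterThanLessThan)
    then have "indicat_real ({l1<..<r1} \<times> {l2<..<r2}) \<in> borel_measurable borel"
      by (intro borel_measurable_indicator borel_open)
    moreover have "indicat_real ({l1<..<r1} \<times> {l2<..<r2}) = ?ind"
      by (auto simp: indicator_def)
    ultimately have [measurable]: "?ind \<in> borel_measurable torus"
      using measurable_torus by metis
    have "(LINT z:box p q \<inter> torus_square|torus. f z) = (\<integral>z. f z * ?ind z \<partial>torus)"
      unfolding set_lebesgue_integral_def
    proof (rule integral_cong_AE)
      show "(\<lambda>z. indicat_real (box p q \<inter> torus_square) z *\<^sub>R f z) \<in> borel_measurable torus"
        using meas[of "box p q"] by measurable
      show "(\<lambda>z. f z * ?ind z) \<in> borel_measurable torus" by measurable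
      show "AE z in torus. indicat_real (box p q \<inter> torus_square) z *\<^sub>R f z = f z * ?ind z"
        using AE_torus_interior AE_space
      proof eventually_elim
        case (elim z)
        then show ?case
          by (cases z; cases p; cases q)
            (auto simp: l1_def l2_def r1_def r2_def box_def Basis_prod_def indicator_def)
      qed
    qed
    also have "\<dots> = 0"
    proof (cases "l1 < r1 \<and> l2 < r2")
      case False
      then have "f z * ?ind z = 0" for z by (auto simp: indicator_def)
      then show ?thesis by (simp only: Bochner_Integration.integral_zero)
    next
      case True
      let ?F = "\<lambda>n c. arc_bump l1 r1 n (fst c) * arc_bump l2 r2 n (snd c)"
      let ?G = "\<lambda>n (z::real\<times>real). f z * ?F n (cis (fst z), cis (snd z))"
      have Fc: "continuous_on UNIV (?F n)" for n
        unfolding arc_bump_def by (intro continuous_intros)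
      have Gm: "(\<lambda>z. ?F n (cis (fst z), cis (snd z))) \<in> borel_measurable torus" for n
        by (intro measurable_torus borel_measurable_continuous_onI
            continuous_on_compose2[OF Fc]) (auto intro!: continuous_intros)
      have "(\<lambda>n. \<integral>z. ?G n z \<partial>torus) \<longlonglongrightarrow> (\<integral>z. f z * ?ind z \<partial>torus)"
      proof (rule integral_dominated_convergence[where w = "\<lambda>z. \<bar>f z\<bar>"])
        show "(\<lambda>z. f z * ?ind z) \<in> borel_measurable torus" by measurable
        show "?G n \<in> borel_measurable torus" for n using Gm[of n] by measurable
        show "integrable torus (\<lambda>z. \<bar>f z\<bar>)" using f by auto
        show "AE z in torus. (\<lambda>n. ?G n z) \<longlonglongrightarrow> f z * ?ind z"
        proof (rule AE_I2)
          fix z assume "z \<in> space torus"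
          then show "(\<lambda>n. ?G n z) \<longlonglongrightarrow> f z * ?ind z"
            using True by (intro tendsto_mult tendsto_const)
              (auto intro!: arc_bump_limit simp: l1_def l2_def r1_def r2_def)
        qed
        show "AE z in torus. norm (?G n z) \<le> \<bar>f z\<bar>" for n
        proof (rule AE_I2)
          fix z :: "real \<times> real"
          have "\<bar>?F n (cis (fst z), cis (snd z))\<bar> \<le> 1"
            using arc_bump_bounds by (auto simp: abs_mult intro!: mult_le_one)
          then show "norm (?G n z) \<le> \<bar>f z\<bar>"
            by (simp only: real_norm_def abs_mult[of "f z"]) (rule mult_left_le, auto)
        qed
      qed
      moreover have "(\<integral>z. ?G n z \<partial>torus) = 0" for n
        by (rule orthogonal_continuous[OF f orth Fc])
      ultimately show ?thesis by (simp add: LIMSEQ_const_iff)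
    qed
    finally show ?thesis by (simp add: P_def)
  qed
  have P: "P A" if A: "A \<in> sets borel" for A
  proof -
    let ?G = "range (\<lambda>(a, b). box a b :: (real \<times> real) set)"
    have "(borel :: (real \<times> real) measure) = sigma UNIV ?G"
      by (rule borel_eq_box)
    then have sets_eq: "sets borel = sigma_sets UNIV ?G"
      by (metis sets_measure_of subset_UNIV Pow_UNIV)
    have box_in: "box a b \<in> ?G" for a b
      by (rule image_eqI[of _ _ "(a, b)"]) simp_all
    have int: "Int_stable ?G"
    proof (rule Int_stableI)
      fix X Y assume "X \<in> ?G" "Y \<in> ?G"
      then obtain p q where "X = box (fst p) (snd p)" "Y = box (fst q) (snd q)"
        unfolding case_prod_beta by blast
      then show "X \<inter> Y \<in> ?G" by (simp only: box_Int_box box_in)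
    qed
    have A': "A \<in> sigma_sets UNIV ?G" using A sets_eq by simp
    have compl: "P (UNIV - A)" if A: "A \<in> sigma_sets UNIV ?G" and PA: "P A" for A
    proof -
      have "A \<in> sets borel" using A by (simp only: sets_eq)
      then have m: "A \<in> sets borel" "UNIV - A \<in> sets borel"
        using sets.compl_sets[of A borel] by (simp_all only: space_borel)
      have "A \<inter> torus_square \<union> (UNIV - A) \<inter> torus_square = torus_square" by blast
      then have "(LINT z:torus_square|torus. f z) =
          (LINT z:A \<inter> torus_square|torus. f z) + (LINT z:(UNIV - A) \<inter> torus_square|torus. f z)"
        using set_integral_Un[OF _ set_int[OF meas[OF m(1)]] set_int[OF meas[OF m(2)]]] by auto
      moreover have "(LINT z:torus_square|torus. f z) = 0"
        using total set_integral_space[OF f] by simp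
      ultimately show ?thesis using PA by (simp add: P_def)
    qed
    have union: "P (\<Union>i. A i)"
      if disj: "disjoint_family A" and sub: "range A \<subseteq> sigma_sets UNIV ?G" and PA: "\<And>i. P (A i)"
      for A :: "nat \<Rightarrow> _"
    proof -
      have m: "A i \<in> sets borel" for i using sub sets_eq by blast
      have "(LINT z:(\<Union>i. A i \<inter> torus_square)|torus. f z) =
          (\<Sum>i. LINT z:A i \<inter> torus_square|torus. f z)"
      proof (rule lebesgue_integral_countable_add)
        show "A i \<inter> torus_square \<in> sets torus" for i by (rule meas[OF m])
        then show "set_integrable torus (\<Union>i. A i \<inter> torus_square) f"
          by (intro set_int sets.countable_UN) auto
        show "A i \<inter> torus_square \<inter> (A j \<inter> torus_square) = {}" if "i \<noteq> j" for i j
          using disj that unfolding disjoint_family_on_def by blast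
      qed
      also have "\<dots> = 0" using PA by (simp add: P_def)
      finally show ?thesis unfolding P_def by (simp only: UN_extend_simps(4))
    qed
    have empty: "P {}" by (simp add: P_def set_lebesgue_integral_def)
    have basic: "P X" if "X \<in> ?G" for X using that box unfolding case_prod_beta by blast
    show ?thesis
      by (rule sigma_sets_induct_disjoint[OF int _ A' basic empty compl union]) simp_all
  qed
  show ?thesis
  proof (rule density_unique_real)
    fix A assume "A \<in> sets torus"
    then have "A \<in> sets borel" "A \<inter> torus_square = A" by (auto simp: sets_torus)
    with P[of A] show "(LINT z:A|torus. f z) = (LINT z:A|torus. 0)"
      by (simp add: P_def set_lebesgue_integral_def)
  qed (use f in auto)
qed

lemma torus_L2_eq_zeroI:
  assumes f: "sq_integrable f" and orth: "\<And>\<phi>. \<phi> \<in> torus_test \<Longrightarrow> (\<integral>z. f z * \<phi> z \<partial>torus) = 0"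
  shows "AE z in torus. f z = 0"
proof -
  have int: "integrable torus f" by (rule sq_integrable_integrable[OF f])
  have p0: "(\<integral>z. f z * of_real (p (cis (fst z), cis (snd z))) \<partial>torus) = 0"
      "integrable torus (\<lambda>z. f z * of_real (p (cis (fst z), cis (snd z))))"
    if "real_polynomial_function p" for p
    using orth[OF test_real_polynomial[OF that]] integrable_test_mult[OF f test_real_polynomial[OF that]]
    by auto
  have "AE z in torus. Re (f z) = 0"
  proof (rule orthogonal_imp_zero)
    show "integrable torus (\<lambda>z. Re (f z))" using int by (rule integrable_Re)
    fix p :: "complex \<times> complex \<Rightarrow> real" assume "real_polynomial_function p"
    from p0[OF this] integral_Re[OF p0(2)[OF this]]
    show "(\<integral>z. Re (f z) * p (cis (fst z), cis (snd z)) \<partial>torus) = 0" by simp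
  qed
  moreover have "AE z in torus. Im (f z) = 0"
  proof (rule orthogonal_imp_zero)
    show "integrable torus (\<lambda>z. Im (f z))" using int by (rule integrable_Im)
    fix p :: "complex \<times> complex \<Rightarrow> real" assume "real_polynomial_function p"
    from p0[OF this] integral_Im[OF p0(2)[OF this]]
    show "(\<integral>z. Im (f z) * p (cis (fst z), cis (snd z)) \<partial>torus) = 0" by simp
  qed
  ultimately show ?thesis by eventually_elim (simp add: complex_eq_iff)
qed

lemma has_weak_deriv_unique:
  assumes "has_weak_deriv a b u w" "has_weak_deriv a b u w'" shows "w = w'"
  using assms
proof transfer
  fix a b u w w'
  assume rel: "torus_rel u u" "torus_rel w w" "torus_rel w' w'"
    and w: "\<forall>\<phi>\<in>torus_test. (\<integral>z. u z * (partial_x ^^ a) ((partial_y ^^ b) \<phi>) z \<partial>torus) =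
               (- 1) ^ (a + b) * (\<integral>z. w z * \<phi> z \<partial>torus)"
    and w': "\<forall>\<phi>\<in>torus_test. (\<integral>z. u z * (partial_x ^^ a) ((partial_y ^^ b) \<phi>) z \<partial>torus) =
               (- 1) ^ (a + b) * (\<integral>z. w' z * \<phi> z \<partial>torus)"
  then have sq: "sq_integrable w" "sq_integrable w'" by (simp_all add: torus_rel_refl)
  have "AE z in torus. w z + (- 1) * w' z = 0"
  proof (rule torus_L2_eq_zeroI)
    show "sq_integrable (\<lambda>z. w z + (- 1) * w' z)"
      by (intro sq_integrable_add sq_integrable_cmult sq)
    fix \<phi> assume \<phi>: "\<phi> \<in> torus_test"
    have "(\<integral>z. w z * \<phi> z - w' z * \<phi> z \<partial>torus) = 0"
      using w[rule_format, OF \<phi>] w'[rule_format, OF \<phi>] integrable_test_mult[OF sq(1) \<phi>]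
        integrable_test_mult[OF sq(2) \<phi>] by simp
    then show "(\<integral>z. (w z + (- 1) * w' z) * \<phi> z \<partial>torus) = 0" by (simp add: algebra_simps)
  qed
  then show "torus_rel w w'" using sq by (auto simp: torus_rel_def)
qed

lemma weak_deriv_eqI: "has_weak_deriv a b u w \<Longrightarrow> weak_deriv a b u = w"
  unfolding weak_deriv_def by (rule the_equality) (auto intro: has_weak_deriv_unique)

lemma has_weak_deriv_0: "has_weak_deriv 0 0 u u"
  by transfer simp

lemma has_weak_deriv_zero: "has_weak_deriv a b 0 0"
  by transfer simp

lemma has_weak_deriv_add:
  assumes "has_weak_deriv a b u w" "has_weak_deriv a b u' w'"
  shows "has_weak_deriv a b (u + u') (w + w')"
  using assms
proof transfer
  fix a b u w u' w'
  assume rel: "torus_rel u u" "torus_rel w w" "torus_rel u' u'" "torus_rel w' w'"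
    and *: "\<forall>\<phi>\<in>torus_test. (\<integral>z. u z * (partial_x ^^ a) ((partial_y ^^ b) \<phi>) z \<partial>torus) =
               (- 1) ^ (a + b) * (\<integral>z. w z * \<phi> z \<partial>torus)"
      "\<forall>\<phi>\<in>torus_test. (\<integral>z. u' z * (partial_x ^^ a) ((partial_y ^^ b) \<phi>) z \<partial>torus) =
               (- 1) ^ (a + b) * (\<integral>z. w' z * \<phi> z \<partial>torus)"
  show "\<forall>\<phi>\<in>torus_test. (\<integral>z. (u z + u' z) * (partial_x ^^ a) ((partial_y ^^ b) \<phi>) z \<partial>torus) =
               (- 1) ^ (a + b) * (\<integral>z. (w z + w' z) * \<phi> z \<partial>torus)"
  proof
    fix \<phi> assume \<phi>: "\<phi> \<in> torus_test"
    have add: "(\<integral>z. (f z + g z) * \<psi> z \<partial>torus) = (\<integral>z. f z * \<psi> z \<partial>torus) + (\<integral>z. g z * \<psi> z \<partial>torus)"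
      if "torus_rel f f" "torus_rel g g" "\<psi> \<in> torus_test" for f g \<psi>
      unfolding distrib_right using that
      by (intro Bochner_Integration.integral_add integrable_test_mult) (auto simp: torus_rel_refl)
    show "(\<integral>z. (u z + u' z) * (partial_x ^^ a) ((partial_y ^^ b) \<phi>) z \<partial>torus) =
               (- 1) ^ (a + b) * (\<integral>z. (w z + w' z) * \<phi> z \<partial>torus)"
      unfolding add[OF rel(1,3) test_deriv[OF \<phi>]] add[OF rel(2,4) \<phi>]
        *(1)[rule_format, OF \<phi>] *(2)[rule_format, OF \<phi>] distrib_left ..
  qed
qed

lemma has_weak_deriv_scaleC:
  assumes "has_weak_deriv a b u w" shows "has_weak_deriv a b (c *\<^sub>C u) (c *\<^sub>C w)"
  using assms
proof transfer
  fix a b u w c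
  assume *: "\<forall>\<phi>\<in>torus_test. (\<integral>z. u z * (partial_x ^^ a) ((partial_y ^^ b) \<phi>) z \<partial>torus) =
               (- 1) ^ (a + b) * (\<integral>z. w z * \<phi> z \<partial>torus)"
  show "\<forall>\<phi>\<in>torus_test. (\<integral>z. (c * u z) * (partial_x ^^ a) ((partial_y ^^ b) \<phi>) z \<partial>torus) =
               (- 1) ^ (a + b) * (\<integral>z. (c * w z) * \<phi> z \<partial>torus)"
    unfolding mult.assoc[of c] integral_mult_right_zero
  proof
    fix \<phi> assume "\<phi> \<in> torus_test"
    with * show "c * (\<integral>z. u z * (partial_x ^^ a) ((partial_y ^^ b) \<phi>) z \<partial>torus) =
        (- 1) ^ (a + b) * (c * (\<integral>z. w z * \<phi> z \<partial>torus))"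
      by simp
  qed
qed


section \<open>Sobolev spaces\<close>

definition sobolev :: "nat \<Rightarrow> torus_L2 set" where
  "sobolev k = {u. \<forall>a b. a + b \<le> k \<longrightarrow> (\<exists>w. has_weak_deriv a b u w)}"

lemma has_weak_deriv_weak_deriv:
  "u \<in> sobolev k \<Longrightarrow> a + b \<le> k \<Longrightarrow> has_weak_deriv a b u (weak_deriv a b u)"
proof -
  assume "u \<in> sobolev k" "a + b \<le> k"
  then obtain w where w: "has_weak_deriv a b u w"
    unfolding sobolev_def by blast
  show ?thesis using w unfolding weak_deriv_eqI[OF w] .
qed

lemma sobolev_zero: "0 \<in> sobolev k"
  unfolding sobolev_def using has_weak_deriv_zero by blast

lemma sobolev_add: "u \<in> sobolev k \<Longrightarrow> w \<in> sobolev k \<Longrightarrow> u + w \<in> sobolev k"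
  unfolding sobolev_def using has_weak_deriv_add by blast

lemma sobolev_scaleC: "u \<in> sobolev k \<Longrightarrow> c *\<^sub>C u \<in> sobolev k"
  unfolding sobolev_def using has_weak_deriv_scaleC by blast

lemma sobolev_scaleR: "u \<in> sobolev k \<Longrightarrow> r *\<^sub>R u \<in> sobolev k"
  by (simp add: scaleR_scaleC sobolev_scaleC)

lemma sobolev_uminus: "u \<in> sobolev k \<Longrightarrow> - u \<in> sobolev k"
  using sobolev_scaleR[of u k "- 1"] by simp

lemma weak_deriv_add:
  "u \<in> sobolev k \<Longrightarrow> w \<in> sobolev k \<Longrightarrow> a + b \<le> k \<Longrightarrow>
    weak_deriv a b (u + w) = weak_deriv a b u + weak_deriv a b w"
  by (rule weak_deriv_eqI, rule has_weak_deriv_add) (rule has_weak_deriv_weak_deriv, assumption+)+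

lemma weak_deriv_scaleC:
  "u \<in> sobolev k \<Longrightarrow> a + b \<le> k \<Longrightarrow> weak_deriv a b (c *\<^sub>C u) = c *\<^sub>C weak_deriv a b u"
  by (rule weak_deriv_eqI, rule has_weak_deriv_scaleC, rule has_weak_deriv_weak_deriv)

lemma weak_deriv_scaleR:
  "u \<in> sobolev k \<Longrightarrow> a + b \<le> k \<Longrightarrow> weak_deriv a b (r *\<^sub>R u) = r *\<^sub>R weak_deriv a b u"
  by (simp add: scaleR_scaleC weak_deriv_scaleC)

definition sobolev_inner :: "nat \<Rightarrow> torus_L2 \<Rightarrow> torus_L2 \<Rightarrow> real" where
  "sobolev_inner k u w = (\<Sum>(a, b) | a + b \<le> k. inner (weak_deriv a b u) (weak_deriv a b w))"

definition sobolev_norm :: "nat \<Rightarrow> torus_L2 \<Rightarrow> real" where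
  "sobolev_norm k u = sqrt (\<Sum>(a, b) | a + b \<le> k. (norm (weak_deriv a b u))\<^sup>2)"

lemma finite_multi_indices: "finite {(a :: nat, b). a + b \<le> k}"
  by (rule finite_subset[of _ "{..k} \<times> {..k}"]) auto

typedef torus_W1 = "sobolev 1"
  morphisms W1_to_L2 Abs_W1
  using sobolev_zero by blast

setup_lifting type_definition_torus_W1

instantiation torus_W1 :: real_vector
begin

lift_definition zero_torus_W1 :: torus_W1 is 0 by (rule sobolev_zero)
lift_definition plus_torus_W1 :: "torus_W1 \<Rightarrow> torus_W1 \<Rightarrow> torus_W1" is "(+)" by (rule sobolev_add)
lift_definition uminus_torus_W1 :: "torus_W1 \<Rightarrow> torus_W1" is uminus by (rule sobolev_uminus)
lift_definition minus_torus_W1 :: "torus_W1 \<Rightarrow> torus_W1 \<Rightarrow> torus_W1" is "(-)"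
  using sobolev_add sobolev_uminus by (metis diff_conv_add_uminus)
lift_definition scaleR_torus_W1 :: "real \<Rightarrow> torus_W1 \<Rightarrow> torus_W1" is scaleR
  by (rule sobolev_scaleR)

instance
proof
  fix u v w :: torus_W1 and r s :: real
  show "u + v + w = u + (v + w)" by transfer (rule add.assoc)
  show "u + v = v + u" by transfer (rule add.commute)
  show "0 + u = u" by transfer (rule add_0)
  show "- u + u = 0" by transfer (rule left_minus)
  show "u - v = u + - v" by transfer (rule diff_conv_add_uminus)
  show "r *\<^sub>R (u + v) = r *\<^sub>R u + r *\<^sub>R v" by transfer (rule scaleR_add_right)
  show "(r + s) *\<^sub>R u = r *\<^sub>R u + s *\<^sub>R u" by transfer (rule scaleR_add_left)
  show "r *\<^sub>R s *\<^sub>R u = (r * s) *\<^sub>R u" by transfer (rule scaleR_scaleR)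
  show "1 *\<^sub>R u = u" by transfer (rule scaleR_one)
qed

end

instantiation torus_W1 :: real_inner
begin

lift_definition inner_torus_W1 :: "torus_W1 \<Rightarrow> torus_W1 \<Rightarrow> real" is "sobolev_inner 1" .
lift_definition norm_torus_W1 :: "torus_W1 \<Rightarrow> real" is "sobolev_norm 1" .

definition dist_torus_W1 :: "torus_W1 \<Rightarrow> torus_W1 \<Rightarrow> real" where
  "dist_torus_W1 u w = norm (u - w)"

definition sgn_torus_W1 :: "torus_W1 \<Rightarrow> torus_W1" where
  "sgn_torus_W1 u = u /\<^sub>R norm u"

definition uniformity_torus_W1 :: "(torus_W1 \<times> torus_W1) filter" where
  "uniformity_torus_W1 = (INF e\<in>{0<..}. principal {(u, w). dist u w < e})"

definition open_torus_W1 :: "torus_W1 set \<Rightarrow> bool" where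
  "open_torus_W1 U \<longleftrightarrow> (\<forall>x\<in>U. \<forall>\<^sub>F (x', y) in uniformity. x' = x \<longrightarrow> y \<in> U)"

instance
proof
  fix u v w :: torus_W1 and r :: real and U :: "torus_W1 set"
  show "sgn u = u /\<^sub>R norm u"
    by (rule sgn_torus_W1_def)
  show "dist u w = norm (u - w)"
    by (rule dist_torus_W1_def)
  show "uniformity = (INF e\<in>{0<..}. principal {(x, y :: torus_W1). dist x y < e})"
    by (rule uniformity_torus_W1_def)
  show "open U \<longleftrightarrow> (\<forall>x\<in>U. \<forall>\<^sub>F (x', y) in uniformity. x' = x \<longrightarrow> y \<in> U)"
    by (rule open_torus_W1_def)
  show "inner u w = inner w u"
    by transfer (simp add: sobolev_inner_def inner_commute)
  show "inner (u + v) w = inner u w + inner v w"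
    by transfer (auto simp: sobolev_inner_def weak_deriv_add[of _ 1] inner_add_left
        simp flip: sum.distrib intro!: sum.cong)
  show "inner (r *\<^sub>R u) w = r * inner u w"
    by transfer (auto simp: sobolev_inner_def weak_deriv_scaleR[of _ 1] sum_distrib_left intro!: sum.cong)
  show "0 \<le> inner u u"
    by transfer (auto simp: sobolev_inner_def intro!: sum_nonneg)
  show "inner u u = 0 \<longleftrightarrow> u = 0"
  proof transfer
    fix u assume "u \<in> sobolev 1"
    show "sobolev_inner 1 u u = 0 \<longleftrightarrow> u = 0"
    proof
      assume "sobolev_inner 1 u u = 0"
      then have "inner (weak_deriv 0 0 u) (weak_deriv 0 0 u) = 0"
        unfolding sobolev_inner_def
        by (subst (asm) sum_nonneg_eq_0_iff) (auto simp: finite_multi_indices)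
      then show "u = 0" by (simp add: weak_deriv_eqI[OF has_weak_deriv_0])
    qed (auto simp: sobolev_inner_def weak_deriv_eqI[OF has_weak_deriv_zero])
  qed
  show "norm u = sqrt (inner u u)"
    by transfer (simp add: sobolev_norm_def sobolev_inner_def power2_norm_eq_inner)
qed

end

instantiation torus_W1 :: complex_normed_vector
begin

lift_definition scaleC_torus_W1 :: "complex \<Rightarrow> torus_W1 \<Rightarrow> torus_W1" is scaleC
  by (rule sobolev_scaleC)

instance
proof
  fix u w :: torus_W1 and r :: real and c d :: complex
  show "c *\<^sub>C (u + w) = c *\<^sub>C u + c *\<^sub>C w"
    by transfer (rule scaleC_add_right)
  show "(c + d) *\<^sub>C u = c *\<^sub>C u + d *\<^sub>C u"
    by transfer (rule scaleC_add_left)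
  show "c *\<^sub>C d *\<^sub>C u = (c * d) *\<^sub>C u"
    by transfer (rule scaleC_scaleC)
  show "r *\<^sub>R u = of_real r *\<^sub>C u"
    by transfer (rule scaleR_scaleC)
  show "norm (c *\<^sub>C u) = cmod c * norm u"
  proof transfer
    fix c u assume u: "u \<in> sobolev 1"
    have "(\<Sum>(a, b) | a + b \<le> 1. (norm (weak_deriv a b (c *\<^sub>C u)))\<^sup>2) =
        (cmod c)\<^sup>2 * (\<Sum>(a, b) | a + b \<le> 1. (norm (weak_deriv a b u))\<^sup>2)"
      by (auto simp: sum_distrib_left weak_deriv_scaleC[OF u] norm_scaleC power_mult_distrib
          intro!: sum.cong)
    then show "sobolev_norm 1 (c *\<^sub>C u) = cmod c * sobolev_norm 1 u"
      by (simp add: sobolev_norm_def real_sqrt_mult)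
  qed
qed

end


section \<open>The operator\<close>

lift_definition mult_M :: "torus_L2 \<Rightarrow> torus_L2" is "\<lambda>h (x, y). exp (\<i> * of_real y) * h (x, y)"
proof -
  have 1: "(\<lambda>(x, y). exp (\<i> * complex_of_real y) * f (x, y)) =
      (\<lambda>z. exp (\<i> * complex_of_real (snd z)) * f z)" for f :: "real \<times> real \<Rightarrow> complex"
    by auto
  have 2: "sq_integrable (\<lambda>z. exp (\<i> * complex_of_real (snd z)) * f z)" if "sq_integrable f" for f
  proof -
    have [measurable]: "f \<in> borel_measurable borel" using that by (simp add: sq_integrable_def)
    have "(\<lambda>z::real \<times> real. exp (\<i> * complex_of_real (snd z))) \<in> borel_measurable borel"
      by (intro borel_measurable_continuous_onI continuous_intros)
    then show ?thesis
      using that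
      by (auto simp: sq_integrable_def biperiodic_def norm_mult power_mult_distrib
          exp_add distrib_left mult.commute)
  qed
  fix f g assume "torus_rel f g"
  then show "torus_rel (\<lambda>(x, y). exp (\<i> * complex_of_real y) * f (x, y))
      (\<lambda>(x, y). exp (\<i> * complex_of_real y) * g (x, y))"
    unfolding 1 by (auto simp: torus_rel_def 2)
qed

text \<open>
  The product type carries the Hilbert product norm. The type \<open>torus_W1\<close> already provides the norm
  of the first factor, and \<open>W1_to_L2\<close> is the inclusion of the Sobolev space into the
  square-integrable functions.
\<close>

type_synonym torus_H = "torus_W1 \<times> torus_L2"

text \<open>Only meaningful on \<open>sobolev 2\<close>.\<close>

definition laplacian :: "torus_L2 \<Rightarrow> torus_L2" where
  "laplacian u = weak_deriv 2 0 u + weak_deriv 0 2 u"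

definition dom_A :: "torus_H set" where
  "dom_A = {(u, v). W1_to_L2 u \<in> sobolev 2 \<and> v \<in> sobolev 1}"

text \<open>Only meaningful on \<open>dom_A\<close>, where \<open>v\<close> does lie in the range of \<open>W1_to_L2\<close>.\<close>

definition op_A :: "torus_H \<Rightarrow> torus_H" where
  "op_A = (\<lambda>(u, v).
     (- Abs_W1 v, - laplacian (W1_to_L2 u) - mult_M (weak_deriv 1 0 (W1_to_L2 u))))"

end

theory Submission
  imports Defs
begin

text \<open>
  On the domain of \<open>A\<close> the wave energy \<open>E = \<parallel>u\<^sub>x\<parallel>\<^sup>2 + \<parallel>u\<^sub>y\<parallel>\<^sup>2 + \<parallel>v\<parallel>\<^sup>2\<close> of an orbit \<open>(u, v)\<close> satisfies
  \<open>E' = 2 Re \<langle>v, M u\<^sub>x\<rangle>\<close>, since the Laplacian cancels against the gradient terms. As multiplication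
  by \<open>e\<^sup>i\<^sup>y\<close> is isometric, \<open>\<bar>E'\<bar> \<le> 2 \<parallel>v\<parallel> \<parallel>u\<^sub>x\<parallel> \<le> E\<close>, so \<open>E(t) \<le> e\<^bsup>\<bar>t\<bar>\<^esup> E(0)\<close>. Integrating \<open>u' = v\<close> bounds
  \<open>\<parallel>u(t)\<parallel>\<close>, and altogether \<open>\<parallel>T\<^sub>t\<parallel> \<le> 4 e\<^bsup>\<bar>t\<bar>/2\<^esup>\<close> on the domain of \<open>A\<close>. This is stronger than the
  claim because \<open>\<bar>t\<bar> / sqrt (log \<bar>t\<bar>) \<ge> 1\<close> for \<open>\<bar>t\<bar> > 1\<close>.

  Both the integration by parts for weak derivatives and the density of the domain come from
  truncated Fourier series, which commute with weak derivatives and converge in \<open>L\<^sup>2\<close>: by Bessel's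
  inequality they are Cauchy, and a function with vanishing Fourier coefficients is zero.
\<close>

section \<open>Exponentials on the torus\<close>

definition torus_exp :: "int \<Rightarrow> int \<Rightarrow> real \<times> real \<Rightarrow> complex" where
  "torus_exp m n z = cis (of_int m * fst z + of_int n * snd z)"

lemma torus_exp_0 [simp]: "torus_exp 0 0 z = 1"
  by (simp add: torus_exp_def)

lemma torus_exp_mult: "torus_exp m n z * torus_exp m' n' z = torus_exp (m + m') (n + n') z"
  by (simp add: torus_exp_def cis_mult algebra_simps)

lemma cnj_torus_exp: "cnj (torus_exp m n z) = torus_exp (- m) (- n) z"
  by (simp add: torus_exp_def flip: cis_cnj) (simp add: cis_cnj)

lemma norm_torus_exp [simp]: "cmod (torus_exp m n z) = 1"
  by (simp add: torus_exp_def)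

text \<open>The factor \<open>c\<close> stays arbitrary because differentiation only changes this
  factor. Inductions over the order of differentiation can then reuse the same formula.\<close>

lemma has_partials_torus_exp:
  "has_partials (\<lambda>z. c * torus_exp m n z)
    (\<lambda>z. (c * (\<i> * of_int m)) * torus_exp m n z) (\<lambda>z. (c * (\<i> * of_int n)) * torus_exp m n z)"
proof -
  have "((\<lambda>z. c * exp (\<i> * of_real (of_int m * fst z + of_int n * snd z))) has_derivative
     (\<lambda>h. fst h *\<^sub>R ((c * (\<i> * of_int m)) * exp (\<i> * of_real (of_int m * fst z + of_int n * snd z)))
        + snd h *\<^sub>R ((c * (\<i> * of_int n)) * exp (\<i> * of_real (of_int m * fst z + of_int n * snd z))))) (at z)"
    for z :: "real \<times> real"
  proof -
    have "((\<lambda>z. \<i> * of_real (of_int m * fst z + of_int n * snd z)) has_derivative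
        (\<lambda>h. \<i> * of_real (of_int m * fst h + of_int n * snd h))) (at z)"
      by (auto intro!: derivative_eq_intros)
    from has_derivative_mult_right[OF has_derivative_compose[OF this
          DERIV_exp[unfolded has_field_derivative_def]]]
    show ?thesis
      by (rule has_derivative_eq_rhs) (simp add: fun_eq_iff scaleR_conv_of_real algebra_simps)
  qed
  then show ?thesis
    by (simp add: has_partials_def torus_exp_def cis_conv_exp)
qed

lemma Ck_torus_exp: "Ck k (\<lambda>z. c * torus_exp m n z)"
proof (induction k arbitrary: c)
  case 0
  show ?case by (auto simp: torus_exp_def intro!: continuous_intros)
next
  case (Suc k)
  show ?case
    unfolding Ck.simps using has_partials_torus_exp Suc[of "c * _"] by blast
qed

lemma torus_exp_test: "(\<lambda>z. c * torus_exp m n z) \<in> torus_test"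
proof -
  have "cis (of_int m * (x + 2 * pi) + of_int n * y) = cis (of_int m * x + of_int n * y)"
       "cis (of_int m * x + of_int n * (y + 2 * pi)) = cis (of_int m * x + of_int n * y)" for x y
    using cis_multiple_2pi[of "of_int m"] cis_multiple_2pi[of "of_int n"]
    by (simp_all add: algebra_simps flip: cis_mult)
  then show ?thesis
    using Ck_torus_exp by (auto simp: torus_test_def biperiodic_def torus_exp_def)
qed

lemma test_mult: "f \<in> torus_test \<Longrightarrow> g \<in> torus_test \<Longrightarrow> (\<lambda>z. f z * g z) \<in> torus_test"
  by (simp add: torus_test_def biperiodic_def Ck_mult)

lemma test_sq_integrable:
  assumes "f \<in> torus_test" shows "sq_integrable f"
proof -
  interpret finite_measure torus by (rule finite_measure_torus)
  have c: "continuous_on UNIV f" using test_continuous[OF assms] .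
  have "integrable torus (\<lambda>z. 1 * (cmod (f z))\<^sup>2)"
    by (rule bounded_torus_integrable_mult) (auto intro!: continuous_intros c)
  then show ?thesis
    using assms c by (auto simp: sq_integrable_def torus_test_def intro: borel_measurable_continuous_onI)
qed

lemma test_integrable: "f \<in> torus_test \<Longrightarrow> integrable torus f"
  by (rule sq_integrable_integrable[OF test_sq_integrable])

lemma partial_torus_exp:
  "(partial_x ^^ a) ((partial_y ^^ b) (torus_exp m n)) =
    (\<lambda>z. ((\<i> * of_int m) ^ a * (\<i> * of_int n) ^ b) * torus_exp m n z)"
proof -
  have p: "partial_x (\<lambda>z. c * torus_exp m n z) = (\<lambda>z. (c * (\<i> * of_int m)) * torus_exp m n z)"
    "partial_y (\<lambda>z. c * torus_exp m n z) = (\<lambda>z. (c * (\<i> * of_int n)) * torus_exp m n z)" for c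
    using dx_dy_eqI[OF has_partials_torus_exp] by auto
  have "(partial_y ^^ b) (torus_exp m n) = (\<lambda>z. (\<i> * of_int n) ^ b * torus_exp m n z)"
    by (induction b) (simp_all only: funpow.simps o_apply p power_0 power_Suc2 mult_1 id_apply)
  moreover have "(partial_x ^^ a) (\<lambda>z. c * torus_exp m n z) =
      (\<lambda>z. (c * (\<i> * of_int m) ^ a) * torus_exp m n z)" for c
    by (induction a) (simp_all only: funpow.simps o_apply p power_Suc2 power_0 mult_1_right id_apply mult.assoc[of c _ "\<i> * of_int m"])
  ultimately show ?thesis by (simp only: mult.commute[of "(\<i> * of_int m) ^ a"])
qed

section \<open>Integration by parts for test functions\<close>

lemma test_has_partials: "f \<in> torus_test \<Longrightarrow> has_partials f (partial_x f) (partial_y f)"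
proof -
  assume "f \<in> torus_test"
  then have "Ck (Suc 0) f" unfolding torus_test_def by blast
  then obtain fx fy where "has_partials f fx fy" by auto
  then show ?thesis using dx_dy_eqI by metis
qed

text \<open>The fundamental theorem of calculus on the closed interval, which differs from the
  half-open one by a null set.\<close>

lemma integral_period_derivative:
  fixes F f :: "real \<Rightarrow> complex"
  assumes "\<And>x. (F has_vector_derivative f x) (at x)" "continuous_on UNIV f" "F (2 * pi) = F 0"
  shows "(\<integral>x. indicator {0..<2 * pi} x *\<^sub>R f x \<partial>lborel) = 0"
proof -
  have [measurable]: "f \<in> borel_measurable borel"
    using assms(2) by (rule borel_measurable_continuous_onI)
  have "(\<integral>x. indicator {0..<2 * pi} x *\<^sub>R f x \<partial>lborel) = (\<integral>x. indicator {0..2 * pi} x *\<^sub>R f x \<partial>lborel)"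
    using AE_lborel_singleton[of "2 * pi"]
    by (intro integral_cong_AE) (auto simp: indicator_def elim!: eventually_mono)
  also have "\<dots> = F (2 * pi) - F 0"
    by (rule integral_FTC_atLeastAtMost)
      (auto intro: has_vector_derivative_at_within assms(1) continuous_on_subset[OF assms(2)])
  finally show ?thesis by (simp add: assms(3))
qed

text \<open>Fubini in both orders, so that the variable of differentiation can be integrated
  first.\<close>

lemma integral_torus_iterated:
  fixes f :: "real \<times> real \<Rightarrow> complex"
  assumes "integrable torus f"
  shows "(\<integral>z. f z \<partial>torus) =
      (\<integral>y. indicator {0..<2 * pi} y *\<^sub>R (\<integral>x. indicator {0..<2 * pi} x *\<^sub>R f (x, y) \<partial>lborel) \<partial>lborel)"
    and "(\<integral>z. f z \<partial>torus) =
      (\<integral>x. indicator {0..<2 * pi} x *\<^sub>R (\<integral>y. indicator {0..<2 * pi} y *\<^sub>R f (x, y) \<partial>lborel) \<partial>lborel)"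
proof -
  let ?g = "\<lambda>x y. indicator torus_square (x, y) *\<^sub>R f (x, y)"
  have "integrable lborel (\<lambda>z. indicator torus_square z *\<^sub>R f z)"
    using assms unfolding torus_def by (subst (asm) integrable_restrict_space) auto
  then have int: "integrable (lborel \<Otimes>\<^sub>M lborel) (case_prod ?g)"
    by (simp add: lborel_prod case_prod_unfold)
  have eq: "(\<integral>z. f z \<partial>torus) = (\<integral>z. case_prod ?g z \<partial>(lborel \<Otimes>\<^sub>M lborel))"
    unfolding torus_def by (subst integral_restrict_space) (auto simp: lborel_prod case_prod_unfold)
  have ind: "?g x y = indicator {0..<2 * pi} y *\<^sub>R (indicator {0..<2 * pi} x *\<^sub>R f (x, y))"
      "?g x y = indicator {0..<2 * pi} x *\<^sub>R (indicator {0..<2 * pi} y *\<^sub>R f (x, y))" for x y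
    by (auto simp: indicator_def)
  show "(\<integral>z. f z \<partial>torus) =
      (\<integral>y. indicator {0..<2 * pi} y *\<^sub>R (\<integral>x. indicator {0..<2 * pi} x *\<^sub>R f (x, y) \<partial>lborel) \<partial>lborel)"
    using eq lborel_pair.integral_snd[OF int] unfolding ind(1) integral_scaleR_right by simp
  show "(\<integral>z. f z \<partial>torus) =
      (\<integral>x. indicator {0..<2 * pi} x *\<^sub>R (\<integral>y. indicator {0..<2 * pi} y *\<^sub>R f (x, y) \<partial>lborel) \<partial>lborel)"
    using eq lborel_pair.integral_fst[OF int] unfolding ind(2) integral_scaleR_right by simp
qed

text \<open>Along each coordinate line the derivative integrates to the change of \<open>f\<close>
  over one period, which is zero.\<close>

lemma integral_partial:
  assumes "f \<in> torus_test"
  shows "(\<integral>z. partial_x f z \<partial>torus) = 0" "(\<integral>z. partial_y f z \<partial>torus) = 0"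
proof -
  have d: "(f has_derivative (\<lambda>h. fst h *\<^sub>R partial_x f z + snd h *\<^sub>R partial_y f z)) (at z)" for z
    using test_has_partials[OF assms] unfolding has_partials_def by (rule spec)
  have c: "continuous_on UNIV (partial_x f)" "continuous_on UNIV (partial_y f)"
    using test_dx_dy[OF assms] test_continuous by auto
  have per: "f (2 * pi, y) = f (0, y)" "f (x, 2 * pi) = f (x, 0)" for x y
    using assms unfolding torus_test_def biperiodic_def by (auto dest: spec[of _ 0] spec[of _ "0::real"])
      (metis add_0)+
  have "((\<lambda>s. f (s, y)) has_vector_derivative partial_x f (x, y)) (at x)"
    "((\<lambda>s. f (x, s)) has_vector_derivative partial_y f (x, y)) (at y)" for x y
  proof -
    have "((\<lambda>s. (s, y)) has_derivative (\<lambda>h. (h, 0))) (at x)"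
      "((\<lambda>s. (x, s)) has_derivative (\<lambda>h. (0, h))) (at y)"
      by (auto intro!: derivative_eq_intros)
    from this[THEN has_derivative_compose[OF _ d]]
    show "((\<lambda>s. f (s, y)) has_vector_derivative partial_x f (x, y)) (at x)"
      "((\<lambda>s. f (x, s)) has_vector_derivative partial_y f (x, y)) (at y)"
      by (simp_all add: has_vector_derivative_def)
  qed
  note deriv = this
  have "(\<integral>x. indicator {0..<2 * pi} x *\<^sub>R partial_x f (x, y) \<partial>lborel) = 0" for y
    by (rule integral_period_derivative[where F = "\<lambda>s. f (s, y)"])
      (auto intro!: deriv per continuous_on_compose2[OF c(1)] continuous_intros)
  moreover have "(\<integral>y. indicator {0..<2 * pi} y *\<^sub>R partial_y f (x, y) \<partial>lborel) = 0" for x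
    by (rule integral_period_derivative[where F = "\<lambda>s. f (x, s)"])
      (auto intro!: deriv per continuous_on_compose2[OF c(2)] continuous_intros)
  ultimately show "(\<integral>z. partial_x f z \<partial>torus) = 0" "(\<integral>z. partial_y f z \<partial>torus) = 0"
    using integral_torus_iterated(1)[OF test_integrable[OF test_dx_dy(1)[OF assms]]]
      integral_torus_iterated(2)[OF test_integrable[OF test_dx_dy(2)[OF assms]]] by simp_all
qed

text \<open>Each integration by parts moves one derivative onto the exponential, an eigenfunction of
  both partial derivatives. The identity says that classical derivatives of exponentials are also
  their weak derivatives.\<close>

lemma integral_torus_exp_partial:
  assumes "f \<in> torus_test"
  shows "(\<integral>z. torus_exp m n z * (partial_x ^^ a) ((partial_y ^^ b) f) z \<partial>torus) =
    (- 1) ^ (a + b) * (\<integral>z. ((\<i> * of_int m) ^ a * (\<i> * of_int n) ^ b) * torus_exp m n z * f z \<partial>torus)"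
proof -
  have e: "torus_exp m n \<in> torus_test" using torus_exp_test[of 1] by simp
  have step: "(\<integral>z. torus_exp m n z * partial_x g z \<partial>torus) = - (\<i> * of_int m) * (\<integral>z. torus_exp m n z * g z \<partial>torus)"
    "(\<integral>z. torus_exp m n z * partial_y g z \<partial>torus) = - (\<i> * of_int n) * (\<integral>z. torus_exp m n z * g z \<partial>torus)"
    if g: "g \<in> torus_test" for g
  proof -
    let ?e = "torus_exp m n"
    have de: "(?e has_derivative (\<lambda>h. fst h *\<^sub>R (\<i> * of_int m * ?e z) + snd h *\<^sub>R (\<i> * of_int n * ?e z))) (at z)" for z
      using has_partials_torus_exp[of 1 m n] unfolding has_partials_def mult_1 by (rule spec)
    \<comment> \<open>By the product rule, each partial derivative of \<open>?e * g\<close> is the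
      sum of the two integrands to be compared, and it integrates to zero because
      \<open>?e * g\<close> is a test function.\<close>
    have "has_partials (\<lambda>z. ?e z * g z)
       (\<lambda>z. ?e z * partial_x g z + \<i> * of_int m * (?e z * g z))
       (\<lambda>z. ?e z * partial_y g z + \<i> * of_int n * (?e z * g z))"
      unfolding has_partials_def
    proof
      fix z
      show "((\<lambda>z. ?e z * g z) has_derivative (\<lambda>h. fst h *\<^sub>R (?e z * partial_x g z + \<i> * of_int m * (?e z * g z))
         + snd h *\<^sub>R (?e z * partial_y g z + \<i> * of_int n * (?e z * g z)))) (at z)"
        using has_derivative_mult[OF de test_has_partials[OF g, unfolded has_partials_def, rule_format], of z]
        by (rule has_derivative_eq_rhs) (simp add: fun_eq_iff algebra_simps scaleR_conv_of_real)
    qed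
    note eqs = dx_dy_eqI[OF this]
    note z = integral_partial[OF test_mult[OF e g], unfolded eqs]
    have i: "integrable torus (\<lambda>z. ?e z * h z)" if "h \<in> torus_test" for h
      by (rule test_integrable[OF test_mult[OF e that]])
    show "(\<integral>z. ?e z * partial_x g z \<partial>torus) = - (\<i> * of_int m) * (\<integral>z. ?e z * g z \<partial>torus)"
      using z(1) i[OF g] i[OF test_dx_dy(1)[OF g]] by (simp add: eq_neg_iff_add_eq_0)
    show "(\<integral>z. ?e z * partial_y g z \<partial>torus) = - (\<i> * of_int n) * (\<integral>z. ?e z * g z \<partial>torus)"
      using z(2) i[OF g] i[OF test_dx_dy(2)[OF g]] by (simp add: eq_neg_iff_add_eq_0)
  qed
  have y: "(partial_y ^^ b) f \<in> torus_test" for b using test_deriv[OF assms, of 0 b] by simp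
  have "(\<integral>z. torus_exp m n z * (partial_y ^^ b) f z \<partial>torus) =
    (- (\<i> * of_int n)) ^ b * (\<integral>z. torus_exp m n z * f z \<partial>torus)" for b
    by (induction b) (simp_all add: step[OF y])
  then have "(\<integral>z. torus_exp m n z * (partial_x ^^ a) ((partial_y ^^ b) f) z \<partial>torus) =
    (- (\<i> * of_int m)) ^ a * ((- (\<i> * of_int n)) ^ b * (\<integral>z. torus_exp m n z * f z \<partial>torus))" for a
    by (induction a) (simp_all add: step[OF test_deriv[OF assms]])
  then show ?thesis
    by (simp add: mult.assoc power_add power_minus[of "\<i> * _"])
qed

section \<open>Orthogonality of the exponentials\<close>

lemma measure_torus: "measure torus torus_square = 4 * pi\<^sup>2"
proof -
  have "emeasure torus torus_square = emeasure (lborel \<Otimes>\<^sub>M lborel) torus_square"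
    by (simp add: torus_def emeasure_restrict_space lborel_prod)
  also have "\<dots> = ennreal (2 * pi) * ennreal (2 * pi)"
    by (subst lborel.emeasure_pair_measure_Times) auto
  also have "\<dots> = ennreal (4 * pi\<^sup>2)"
    by (simp add: power2_eq_square flip: ennreal_mult)
  finally show ?thesis by (simp add: measure_def)
qed

text \<open>A nonzero frequency makes the exponential a multiple of one of its own partial
  derivatives, whose integral vanishes. Frequency zero leaves the area of the torus.\<close>

lemma integral_torus_exp:
  "(\<integral>z. torus_exp m n z \<partial>torus) = (if m = 0 \<and> n = 0 then 4 * of_real (pi\<^sup>2) else 0)"
proof (cases "m = 0 \<and> n = 0")
  case True
  then show ?thesis
    using measure_torus by (auto simp: scaleR_conv_of_real)
next
  case False
  have e: "torus_exp m n \<in> torus_test" using torus_exp_test[of 1] by simp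
  have "\<i> * of_int m * (\<integral>z. torus_exp m n z \<partial>torus) = 0"
    "\<i> * of_int n * (\<integral>z. torus_exp m n z \<partial>torus) = 0"
    using integral_partial[OF e] partial_torus_exp[of 1 0 m n] partial_torus_exp[of 0 1 m n]
    by simp_all
  with False show ?thesis by auto
qed

section \<open>Completeness of \<open>L\<^sup>2\<close>\<close>

lemma torus_L2_repr:
  fixes u :: torus_L2
  obtains f where "sq_integrable f" "u = abs_torus_L2 f"
proof -
  have "\<exists>f. sq_integrable f \<and> u = abs_torus_L2 f"
    by (rule torus_L2.abs_induct) (auto simp: torus_rel_refl)
  then show ?thesis using that by blast
qed

lemma norm_diff_abs_torus_L2:
  assumes "sq_integrable f" "sq_integrable g"
  shows "(norm (abs_torus_L2 f - abs_torus_L2 g))\<^sup>2 = (\<integral>z. (cmod (f z - g z))\<^sup>2 \<partial>torus)"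
    and "sq_integrable (\<lambda>z. f z - g z)"
proof -
  have g: "sq_integrable (\<lambda>z. - g z)" using sq_integrable_cmult[OF assms(2), of "-1"] by simp
  show d: "sq_integrable (\<lambda>z. f z - g z)" using sq_integrable_add[OF assms(1) g] by simp
  have "abs_torus_L2 f - abs_torus_L2 g = abs_torus_L2 (\<lambda>z. f z - g z)"
    using assms g by (simp add: minus_torus_L2_def uminus_torus_L2.abs_eq plus_torus_L2.abs_eq torus_rel_refl)
  with d show "(norm (abs_torus_L2 f - abs_torus_L2 g))\<^sup>2 = (\<integral>z. (cmod (f z - g z))\<^sup>2 \<partial>torus)"
    by (simp add: norm_torus_L2.abs_eq torus_rel_refl)
qed

text \<open>
  Along a subsequence with geometrically decreasing increments the representatives converge almost
  everywhere, as the increments are summable in \<open>L\<^sup>1\<close>; Fatou's lemma identifies the limit.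
\<close>

lemma torus_L2_Cauchy_convergent:
  fixes X :: "nat \<Rightarrow> torus_L2"
  assumes "Cauchy X" shows "convergent X"
proof -
  interpret finite_measure torus by (rule finite_measure_torus)
  have "\<exists>r. strict_mono r \<and> (\<forall>k. norm (X (r (Suc k)) - X (r k)) < (1/2) ^ k)"
  proof -
    have "\<forall>k. \<exists>N. \<forall>m\<ge>N. \<forall>n\<ge>N. norm (X m - X n) < (1/2) ^ k"
      using assms unfolding Cauchy_iff by simp
    then obtain N where N: "\<And>k m n. m \<ge> N k \<Longrightarrow> n \<ge> N k \<Longrightarrow> norm (X m - X n) < (1/2) ^ k" by metis
    \<comment> \<open>The sum makes \<open>r k\<close> at least \<open>N k\<close>, and the
      successors make \<open>r\<close> strictly increasing even where \<open>N\<close> is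
      zero.\<close>
    define r where "r k = (\<Sum>i\<le>k. Suc (N i))" for k
    have "strict_mono r" by (simp add: strict_mono_Suc_iff r_def)
    moreover have "N k \<le> r k" for k unfolding r_def by (cases k) simp_all
    moreover have "N k \<le> r (Suc k)" for k
      using \<open>N k \<le> r k\<close> strict_monoD[OF \<open>strict_mono r\<close>, of k "Suc k"] by simp
    ultimately show ?thesis using N by blast
  qed
  then obtain r where r: "strict_mono r" "\<And>k. norm (X (r (Suc k)) - X (r k)) < (1/2) ^ k" by blast
  have "\<exists>f. sq_integrable f \<and> X n = abs_torus_L2 f" for n using torus_L2_repr by metis
  then obtain f where f: "\<And>n. sq_integrable (f n)" "\<And>n. X n = abs_torus_L2 (f n)" by metis
  have [measurable]: "f n \<in> borel_measurable torus" "f n \<in> borel_measurable borel" for n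
    using f(1) by (auto simp: sq_integrable_def measurable_torus)
  define g where "g k z = f (r (Suc k)) z - f (r k) z" for k z
  have g: "sq_integrable (g k)" for k unfolding g_def by (rule norm_diff_abs_torus_L2(2)[OF f(1) f(1)])
  have [measurable]: "g k \<in> borel_measurable torus" for k
    using g by (auto simp: sq_integrable_def measurable_torus)
  have g2: "(\<integral>z. (cmod (g k z))\<^sup>2 \<partial>torus) \<le> (1/4) ^ k" for k
  proof -
    have "(\<integral>z. (cmod (g k z))\<^sup>2 \<partial>torus) = (norm (X (r (Suc k)) - X (r k)))\<^sup>2"
      unfolding g_def f(2) by (rule norm_diff_abs_torus_L2(1)[OF f(1) f(1), symmetric])
    also have "\<dots> \<le> ((1/2) ^ k)\<^sup>2"
      using r(2)[of k] by (intro power_mono) auto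
    also have "\<dots> = ((1/2)\<^sup>2) ^ k" by (simp only: mult.commute flip: power_mult)
    finally show ?thesis by (simp add: power2_eq_square)
  qed
  have g1: "(\<integral>z. cmod (g k z) \<partial>torus) \<le> (measure torus (space torus) + 1) * (1/2) ^ k" for k
  proof -
    \<comment> \<open>This is \<open>a \<le> 1 + a\<^sup>2\<close> for
      \<open>a = 2 ^ k * cmod (g k z)\<close>, divided by \<open>2 ^ k\<close>. The weight is chosen
      so that the bound \<open>(1/4) ^ k\<close> on the integrated square becomes a multiple of
      \<open>(1/2) ^ k\<close> for the integral itself, which is where the finite area
      enters.\<close>
    have "cmod (g k z) \<le> (1/2) ^ k + 2 ^ k * (cmod (g k z))\<^sup>2" for z
    proof -
      have "0 \<le> (2 ^ k * cmod (g k z) - 1)\<^sup>2 + 2 ^ k * cmod (g k z)" by simp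
      then have "2 ^ k * cmod (g k z) \<le> 1 + (2 ^ k * cmod (g k z))\<^sup>2"
        by (simp add: power2_eq_square algebra_simps)
      then have "(1/2)^k * (2 ^ k * cmod (g k z)) \<le> (1/2)^k * (1 + (2 ^ k * cmod (g k z))\<^sup>2)"
        by (intro mult_left_mono) auto
      also have "(1/2)^k * (1 + (2 ^ k * cmod (g k z))\<^sup>2) =
          (1/2)^k + ((1/2)^k * 2^k) * (2^k * (cmod (g k z))\<^sup>2)"
        by (simp only: power2_eq_square algebra_simps)
      also have "(1/2)^k * (2 ^ k * cmod (g k z)) = ((1/2)^k * 2^k) * cmod (g k z)"
        by (simp only: mult.assoc)
      also have "(1/2)^k * 2^k = (1::real)" by (simp add: power_one_over)
      finally show ?thesis by simp
    qed
    then have "(\<integral>z. cmod (g k z) \<partial>torus) \<le> (\<integral>z. (1/2) ^ k + 2 ^ k * (cmod (g k z))\<^sup>2 \<partial>torus)"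
      using g[of k] sq_integrable_integrable[OF g[of k]]
      by (intro integral_mono) (auto simp: sq_integrable_def)
    also have "\<dots> = measure torus (space torus) * (1/2) ^ k + 2 ^ k * (\<integral>z. (cmod (g k z))\<^sup>2 \<partial>torus)"
      using g[of k] by (subst Bochner_Integration.integral_add) (auto simp: sq_integrable_def)
    also have "\<dots> \<le> measure torus (space torus) * (1/2) ^ k + 2 ^ k * (1/4) ^ k"
      using g2[of k] by (intro add_left_mono mult_left_mono) auto
    also have "2 ^ k * (1/4) ^ k = ((2 * (1/4)) ^ k :: real)" by (simp only: power_mult_distrib)
    finally show ?thesis by (simp add: algebra_simps)
  qed
  have summ: "AE z in torus. summable (\<lambda>k. cmod (g k z))"
  proof -
    have "summable (\<lambda>k. (measure torus (space torus) + 1) * (1/2) ^ k)" by (intro summable_mult) simp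
    then have s: "summable (\<lambda>k. \<integral>z. cmod (g k z) \<partial>torus)"
      by (rule summable_comparison_test[rotated]) (use g1 in auto)
    have "(\<integral>\<^sup>+z. (\<Sum>k. ennreal (cmod (g k z))) \<partial>torus) = (\<Sum>k. \<integral>\<^sup>+z. ennreal (cmod (g k z)) \<partial>torus)"
      by (rule nn_integral_suminf) measurable
    also have "\<dots> = (\<Sum>k. ennreal (\<integral>z. cmod (g k z) \<partial>torus))"
      using sq_integrable_integrable[OF g] by (subst nn_integral_eq_integral) auto
    also have "\<dots> = ennreal (\<Sum>k. \<integral>z. cmod (g k z) \<partial>torus)"
      by (rule suminf_ennreal2[OF _ s]) simp
    finally have "(\<integral>\<^sup>+z. (\<Sum>k. ennreal (cmod (g k z))) \<partial>torus) \<noteq> \<infinity>" by simp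
    then have "AE z in torus. (\<Sum>k. ennreal (cmod (g k z))) \<noteq> \<infinity>"
      by (rule nn_integral_noteq_infinite[rotated]) measurable
    then show ?thesis
      by eventually_elim (rule summable_suminf_not_top, auto)
  qed
  \<comment> \<open>Taking \<open>lim\<close> at every point of the plane keeps \<open>h\<close>
    exactly periodic and Borel measurable, also at points where the sequence diverges.\<close>
  define h where "h z = lim (\<lambda>k. f (r k) z)" for z
  have "(\<lambda>k. f (r k) z) \<longlonglongrightarrow> h z" if "summable (\<lambda>k. cmod (g k z))" for z
  proof -
    from that have "(\<lambda>n. \<Sum>k<n. g k z) \<longlonglongrightarrow> (\<Sum>k. g k z)"
      by (rule summable_LIMSEQ[OF summable_norm_cancel])
    moreover have "(\<Sum>k<n. g k z) = f (r n) z - f (r 0) z" for n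
      unfolding g_def by (rule sum_lessThan_telescope)
    ultimately have "(\<lambda>n. (f (r n) z - f (r 0) z) + f (r 0) z) \<longlonglongrightarrow> (\<Sum>k. g k z) + f (r 0) z"
      by (intro tendsto_add) auto
    then have "convergent (\<lambda>k. f (r k) z)" by (simp add: convergentI)
    then show ?thesis unfolding h_def by (simp only: convergent_LIMSEQ_iff)
  qed
  with summ have lim: "AE z in torus. (\<lambda>k. f (r k) z) \<longlonglongrightarrow> h z"
    by (rule eventually_mono)
  have [measurable]: "h \<in> borel_measurable borel" "h \<in> borel_measurable torus"
    unfolding h_def by measurable
  have bound: "(\<integral>\<^sup>+z. ennreal ((cmod (f n z - h z))\<^sup>2) \<partial>torus) \<le> ennreal (e\<^sup>2)"
    if e: "e > 0" "\<And>m. m \<ge> N \<Longrightarrow> norm (X n - X m) < e" for n N e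
  proof -
    have "(\<integral>\<^sup>+z. ennreal ((cmod (f n z - h z))\<^sup>2) \<partial>torus) =
        (\<integral>\<^sup>+z. liminf (\<lambda>k. ennreal ((cmod (f n z - f (r k) z))\<^sup>2)) \<partial>torus)"
    proof (rule nn_integral_cong_AE)
      show "AE z in torus. ennreal ((cmod (f n z - h z))\<^sup>2) =
          liminf (\<lambda>k. ennreal ((cmod (f n z - f (r k) z))\<^sup>2))"
        using lim
      proof eventually_elim
        case (elim z)
        then have "(\<lambda>k. ennreal ((cmod (f n z - f (r k) z))\<^sup>2)) \<longlonglongrightarrow> ennreal ((cmod (f n z - h z))\<^sup>2)"
          by (intro tendsto_intros)
        from lim_imp_Liminf[OF _ this] show ?case by simp
      qed
    qed
    also have "\<dots> \<le> liminf (\<lambda>k. \<integral>\<^sup>+z. ennreal ((cmod (f n z - f (r k) z))\<^sup>2) \<partial>torus)"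
      by (rule nn_integral_liminf) measurable
    also have "\<dots> \<le> limsup (\<lambda>k. \<integral>\<^sup>+z. ennreal ((cmod (f n z - f (r k) z))\<^sup>2) \<partial>torus)"
      by (rule Liminf_le_Limsup) simp
    also have "\<dots> \<le> ennreal (e\<^sup>2)"
    proof (rule Limsup_bounded)
      have "(\<integral>\<^sup>+z. ennreal ((cmod (f n z - f (r k) z))\<^sup>2) \<partial>torus) \<le> ennreal (e\<^sup>2)" if "k \<ge> N" for k
      proof -
        have "integrable torus (\<lambda>z. (cmod (f n z - f (r k) z))\<^sup>2)"
          using norm_diff_abs_torus_L2(2)[OF f(1) f(1)] by (simp add: sq_integrable_def)
        then have "(\<integral>\<^sup>+z. ennreal ((cmod (f n z - f (r k) z))\<^sup>2) \<partial>torus) = ennreal ((norm (X n - X (r k)))\<^sup>2)"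
          by (simp add: nn_integral_eq_integral f(2) norm_diff_abs_torus_L2(1)[OF f(1) f(1)])
        also have "\<dots> \<le> ennreal (e\<^sup>2)"
          using e(2)[of "r k"] seq_suble[OF r(1), of k] that by (intro ennreal_leI power_mono) auto
        finally show ?thesis .
      qed
      then show "\<forall>\<^sub>F k in sequentially. (\<integral>\<^sup>+z. ennreal ((cmod (f n z - f (r k) z))\<^sup>2) \<partial>torus) \<le> ennreal (e\<^sup>2)"
        unfolding eventually_sequentially by blast
    qed
    finally show ?thesis .
  qed
  have per: "biperiodic h"
    using f(1) by (simp add: h_def sq_integrable_def biperiodic_def)
  have "sq_integrable h"
  proof -
    obtain N where "\<And>m n. m \<ge> N \<Longrightarrow> n \<ge> N \<Longrightarrow> norm (X n - X m) < 1"
      using assms unfolding Cauchy_iff by (metis zero_less_one)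
    from bound[of 1 N N, OF _ this] have "(\<integral>\<^sup>+z. ennreal ((cmod (f N z - h z))\<^sup>2) \<partial>torus) \<le> 1" by simp
    then have "integrable torus (\<lambda>z. (cmod (f N z - h z))\<^sup>2)"
      by (intro integrableI_bounded) (auto simp: le_less_trans)
    moreover have "biperiodic (\<lambda>z. f N z - h z)"
      using per f(1)[of N] by (simp add: sq_integrable_def biperiodic_def)
    ultimately have "sq_integrable (\<lambda>z. f N z - h z)"
      unfolding sq_integrable_def by simp
    \<comment> \<open>Here \<open>h z\<close> is recovered as
      \<open>f N z - (f N z - h z)\<close>.\<close>
    from norm_diff_abs_torus_L2(2)[OF f(1)[of N] this] show ?thesis by simp
  qed
  have "X \<longlonglongrightarrow> abs_torus_L2 h"
  proof (rule LIMSEQ_I)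
    fix e :: real assume "e > 0"
    then obtain N where N: "\<And>m n. m \<ge> N \<Longrightarrow> n \<ge> N \<Longrightarrow> norm (X n - X m) < e / 2"
      using assms unfolding Cauchy_iff by (metis half_gt_zero)
    have "norm (X n - abs_torus_L2 h) < e" if "n \<ge> N" for n
    proof -
      have "integrable torus (\<lambda>z. (cmod (f n z - h z))\<^sup>2)"
        using norm_diff_abs_torus_L2(2)[OF f(1) \<open>sq_integrable h\<close>] by (simp add: sq_integrable_def)
      then have "ennreal ((norm (X n - abs_torus_L2 h))\<^sup>2) \<le> ennreal ((e / 2)\<^sup>2)"
        using bound[of "e / 2" N n] N that \<open>e > 0\<close>
        by (simp add: nn_integral_eq_integral f(2) norm_diff_abs_torus_L2(1)[OF f(1) \<open>sq_integrable h\<close>])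
      then have "(norm (X n - abs_torus_L2 h))\<^sup>2 \<le> (e / 2)\<^sup>2"
        by (subst (asm) ennreal_le_iff) auto
      then have "norm (X n - abs_torus_L2 h) \<le> e / 2"
        by (rule power2_le_imp_le) (use \<open>e > 0\<close> in auto)
      with \<open>e > 0\<close> show ?thesis by simp
    qed
    then show "\<exists>N. \<forall>n\<ge>N. norm (X n - abs_torus_L2 h) < e" by blast
  qed
  then show ?thesis by (rule convergentI)
qed

section \<open>Fourier series\<close>

lemma sq_integrable_torus_exp: "sq_integrable (torus_exp m n)"
  using test_sq_integrable[OF torus_exp_test[of 1]] by simp

lift_definition L2_exp :: "int \<Rightarrow> int \<Rightarrow> torus_L2" is torus_exp
  by (simp add: torus_rel_refl sq_integrable_torus_exp)

lift_definition fourier_coeff :: "torus_L2 \<Rightarrow> int \<Rightarrow> int \<Rightarrow> complex"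
  is "\<lambda>f m n. (\<integral>z. f z * torus_exp (- m) (- n) z \<partial>torus) / (4 * of_real (pi\<^sup>2))"
proof -
  fix f g assume "torus_rel f g"
  note rel = torus_relD[OF this]
  note [measurable] = rel(1,2)
  have [measurable]: "torus_exp m n \<in> borel_measurable torus" for m n
    using sq_integrable_torus_exp by (simp add: sq_integrable_def measurable_torus)
  have "(\<integral>z. f z * torus_exp (- m) (- n) z \<partial>torus) = (\<integral>z. g z * torus_exp (- m) (- n) z \<partial>torus)" for m n
    by (rule integral_cong_AE) (use rel(3) in \<open>auto elim: eventually_mono\<close>)
  then show "(\<lambda>m n. (\<integral>z. f z * torus_exp (- m) (- n) z \<partial>torus) / (4 * of_real (pi\<^sup>2))) =
      (\<lambda>m n. (\<integral>z. g z * torus_exp (- m) (- n) z \<partial>torus) / (4 * of_real (pi\<^sup>2)))"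
    by simp
qed

lemma fourier_coeff_add: "fourier_coeff (u + w) m n = fourier_coeff u m n + fourier_coeff w m n"
proof transfer
  fix f g m n assume "torus_rel f f" "torus_rel g g"
  then have "integrable torus (\<lambda>z. f z * torus_exp (- m) (- n) z)" "integrable torus (\<lambda>z. g z * torus_exp (- m) (- n) z)"
    using integrable_test_mult[OF _ torus_exp_test[of 1]] by (auto simp: torus_rel_refl)
  then show "(\<integral>z. (f z + g z) * torus_exp (- m) (- n) z \<partial>torus) / (4 * of_real (pi\<^sup>2)) =
      (\<integral>z. f z * torus_exp (- m) (- n) z \<partial>torus) / (4 * of_real (pi\<^sup>2)) +
      (\<integral>z. g z * torus_exp (- m) (- n) z \<partial>torus) / (4 * of_real (pi\<^sup>2))"
    by (simp add: distrib_right add_divide_distrib)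
qed

lemma fourier_coeff_scaleC: "fourier_coeff (c *\<^sub>C u) m n = c * fourier_coeff u m n"
  by transfer (simp add: mult.assoc)

lemma fourier_coeff_diff: "fourier_coeff (u - w) m n = fourier_coeff u m n - fourier_coeff w m n"
proof -
  have "u - w = u + (- 1) *\<^sub>C w"
    using scaleR_scaleC[of "- 1" w] by simp
  then show ?thesis
    by (simp only: fourier_coeff_add fourier_coeff_scaleC mult_minus1 diff_conv_add_uminus)
qed

lemma fourier_coeff_zero: "fourier_coeff 0 m n = 0"
  by transfer simp

lemma fourier_coeff_sum: "fourier_coeff (\<Sum>i\<in>I. f i) m n = (\<Sum>i\<in>I. fourier_coeff (f i) m n)"
  by (induction I rule: infinite_finite_induct) (simp_all add: fourier_coeff_add fourier_coeff_zero)

lemma fourier_coeff_exp: "fourier_coeff (L2_exp k l) m n = (if k = m \<and> l = n then 1 else 0)"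
  by transfer (auto simp: torus_exp_mult integral_torus_exp)

text \<open>As \<open>inner\<close> is only the real part of the complex inner product, the free
  factor \<open>c\<close> is needed to reach the whole coefficient. Taking \<open>c\<close> to be
  the coefficient itself yields its squared modulus.\<close>

lemma inner_scaleC_L2_exp:
  "inner u (c *\<^sub>C L2_exp m n) = 4 * pi\<^sup>2 * Re (fourier_coeff u m n * cnj c)"
proof transfer
  fix f c m n assume "torus_rel f f"
  then have i: "integrable torus (\<lambda>z. f z * torus_exp (- m) (- n) z)"
    using integrable_test_mult[OF _ torus_exp_test[of 1]] by (auto simp: torus_rel_refl)
  have "(\<integral>z. Re (f z * cnj (c * torus_exp m n z)) \<partial>torus) =
      (\<integral>z. Re (cnj c * (f z * torus_exp (- m) (- n) z)) \<partial>torus)"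
    by (intro arg_cong[where f = "integral\<^sup>L torus"] ext arg_cong[where f = Re])
      (simp add: cnj_torus_exp mult_ac)
  also have "\<dots> = Re (\<integral>z. cnj c * (f z * torus_exp (- m) (- n) z) \<partial>torus)"
    by (rule integral_Re) (use i in auto)
  also have "(\<integral>z. cnj c * (f z * torus_exp (- m) (- n) z) \<partial>torus) =
      of_real (4 * pi\<^sup>2) * ((\<integral>z. f z * torus_exp (- m) (- n) z \<partial>torus) / (4 * of_real (pi\<^sup>2)) * cnj c)"
    by (simp add: mult.commute)
  also have "Re (of_real (4 * pi\<^sup>2) * w) = 4 * pi\<^sup>2 * Re w" for w
    by simp
  finally show "(\<integral>z. Re (f z * cnj (c * torus_exp m n z)) \<partial>torus) =
      4 * pi\<^sup>2 * Re ((\<integral>z. f z * torus_exp (- m) (- n) z \<partial>torus) / (4 * of_real (pi\<^sup>2)) * cnj c)" .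
qed

text \<open>Test the weak derivative with the exponential of opposite frequency: the sign from the
  definition cancels the signs produced by the negated frequencies.\<close>

lemma fourier_coeff_weak_deriv:
  assumes "has_weak_deriv a b u w"
  shows "fourier_coeff w m n = ((\<i> * of_int m) ^ a * (\<i> * of_int n) ^ b) * fourier_coeff u m n"
  using assms
proof transfer
  fix a b u w m n
  assume *: "\<forall>\<phi>\<in>torus_test. (\<integral>z. u z * (partial_x ^^ a) ((partial_y ^^ b) \<phi>) z \<partial>torus) =
               (- 1) ^ (a + b) * (\<integral>z. w z * \<phi> z \<partial>torus)"
  have e: "torus_exp (- m) (- n) \<in> torus_test" using torus_exp_test[of 1] by simp
  have "(\<integral>z. w z * torus_exp (- m) (- n) z \<partial>torus) =
      (- 1) ^ (a + b) * (\<integral>z. u z * (((\<i> * of_int (- m)) ^ a * (\<i> * of_int (- n)) ^ b) * torus_exp (- m) (- n) z) \<partial>torus)"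
    using *[rule_format, OF e, unfolded partial_torus_exp] by (simp add: flip: mult.assoc power_add)
  also have "\<dots> = (- 1) ^ (a + b) * (((\<i> * of_int (- m)) ^ a * (\<i> * of_int (- n)) ^ b) *
     (\<integral>z. u z * torus_exp (- m) (- n) z \<partial>torus))"
    by (simp add: mult.left_commute[of "u _"])
  also have "\<dots> = ((\<i> * of_int m) ^ a * (\<i> * of_int n) ^ b) * (\<integral>z. u z * torus_exp (- m) (- n) z \<partial>torus)"
    by (simp add: power_add power_minus[of "\<i> * _"] mult_ac)
  finally show "(\<integral>z. w z * torus_exp (- m) (- n) z \<partial>torus) / (4 * of_real (pi\<^sup>2)) =
     ((\<i> * of_int m) ^ a * (\<i> * of_int n) ^ b) *
     ((\<integral>z. u z * torus_exp (- m) (- n) z \<partial>torus) / (4 * of_real (pi\<^sup>2)))"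
    by simp
qed

lemma has_weak_deriv_L2_exp:
  "has_weak_deriv a b (L2_exp m n) (((\<i> * of_int m) ^ a * (\<i> * of_int n) ^ b) *\<^sub>C L2_exp m n)"
  by transfer (use integral_torus_exp_partial in blast)

text \<open>
  The functions all of whose Fourier coefficients vanish are stable under multiplication by
  \<open>cos x\<close>, \<open>sin x\<close>, \<open>cos y\<close> and \<open>sin y\<close>, hence by trigonometric polynomials.
\<close>

definition zero_coeffs :: "(real \<times> real \<Rightarrow> complex) set" where
  "zero_coeffs = {f. sq_integrable f \<and> (\<forall>m n. (\<integral>z. f z * torus_exp m n z \<partial>torus) = 0)}"

lemma zero_coeffs_add:
  assumes "f \<in> zero_coeffs" "g \<in> zero_coeffs" shows "(\<lambda>z. f z + g z) \<in> zero_coeffs"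
  using assms integrable_test_mult[OF _ torus_exp_test[of 1]]
  by (simp add: zero_coeffs_def sq_integrable_add distrib_right)

lemma zero_coeffs_cmult: "f \<in> zero_coeffs \<Longrightarrow> (\<lambda>z. c * f z) \<in> zero_coeffs"
  by (simp add: zero_coeffs_def sq_integrable_cmult mult.assoc)

lemma zero_coeffs_exp:
  assumes "f \<in> zero_coeffs" shows "(\<lambda>z. torus_exp m n z * f z) \<in> zero_coeffs"
proof -
  have "torus_exp m n \<in> torus_test" using torus_exp_test[of 1] by simp
  then have "sq_integrable (\<lambda>z. torus_exp m n z * f z)"
    using assms sq_integrable_torus_exp[of m n]
    by (auto simp: zero_coeffs_def sq_integrable_def biperiodic_def norm_mult)
  moreover have eq: "torus_exp m n z * f z * torus_exp k l z = f z * torus_exp (m + k) (n + l) z" for k l z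
    by (simp only: mult_ac flip: torus_exp_mult)
  ultimately show ?thesis using assms unfolding zero_coeffs_def mem_Collect_eq eq by blast
qed

lemma zero_coeffs_polynomial:
  assumes "real_polynomial_function p" "f \<in> zero_coeffs"
  shows "(\<lambda>z. of_real (p (cis (fst z), cis (snd z))) * f z) \<in> zero_coeffs"
  using assms
proof (induction p arbitrary: f)
  case (linear l)
  then interpret bounded_linear l by simp
  define a b c d where "a = l (1, 0)" and "b = l (\<i>, 0)" and "c = l (0, 1)" and "d = l (0, \<i>)"
  \<comment> \<open>A real-linear functional of two points on the unit circle is a combination of
    their cosines and sines, which Euler's formulas turn into four exponentials.\<close>
  have eq: "complex_of_real (l (cis (fst z), cis (snd z))) =
      ((of_real a - \<i> * of_real b) / 2 * torus_exp 1 0 z + (of_real a + \<i> * of_real b) / 2 * torus_exp (-1) 0 z) +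
      ((of_real c - \<i> * of_real d) / 2 * torus_exp 0 1 z + (of_real c + \<i> * of_real d) / 2 * torus_exp 0 (-1) z)"
    for z
  proof -
    have "(cis (fst z), cis (snd z)) = cos (fst z) *\<^sub>R (1, 0) + sin (fst z) *\<^sub>R (\<i>, 0)
        + cos (snd z) *\<^sub>R (0, 1) + sin (snd z) *\<^sub>R (0, \<i>)"
      by (simp add: complex_eq_iff)
    then have "l (cis (fst z), cis (snd z)) = cos (fst z) * a + sin (fst z) * b + cos (snd z) * c + sin (snd z) * d"
      by (simp add: add scaleR a_def b_def c_def d_def del: scaleR_Pair add_Pair)
    then show ?thesis by (simp add: torus_exp_def complex_eq_iff field_simps)
  qed
  have "(\<lambda>z. (((of_real a - \<i> * of_real b) / 2) * (torus_exp 1 0 z * f z) +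
        ((of_real a + \<i> * of_real b) / 2) * (torus_exp (-1) 0 z * f z)) +
      (((of_real c - \<i> * of_real d) / 2) * (torus_exp 0 1 z * f z) +
       ((of_real c + \<i> * of_real d) / 2) * (torus_exp 0 (-1) z * f z))) \<in> zero_coeffs"
    by (intro zero_coeffs_add zero_coeffs_cmult zero_coeffs_exp \<open>f \<in> zero_coeffs\<close>)
  then show ?case
    unfolding eq distrib_right mult.assoc .
next
  case (const c) then show ?case by (rule zero_coeffs_cmult)
next
  case (add p q)
  from zero_coeffs_add[OF add.IH(1)[OF add.prems] add.IH(2)[OF add.prems]]
  show ?case by (simp add: distrib_right)
next
  case (mult p q)
  \<comment> \<open>As the induction is general in \<open>f\<close>, multiply by \<open>q\<close>
    first and then by \<open>p\<close>.\<close>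
  from mult.IH(1)[OF mult.IH(2)[OF mult.prems]]
  show ?case by (simp add: mult.assoc)
qed

text \<open>The integral of \<open>f\<close> against a trigonometric polynomial is, up to
  normalisation, the coefficient of frequency zero of their product, hence zero. As the polynomials
  are real-valued, the real and imaginary parts of \<open>f\<close> are each orthogonal to all of
  them, so both vanish almost everywhere.\<close>

lemma fourier_coeffs_zero_imp_zero:
  assumes "\<And>m n. fourier_coeff u m n = 0" shows "u = 0"
  using assms
proof transfer
  fix f
  assume "torus_rel f f" and c: "\<And>m n. (\<integral>z. f z * torus_exp (- m) (- n) z \<partial>torus) / (4 * of_real (pi\<^sup>2)) = 0"
  then have f: "sq_integrable f" by (simp add: torus_rel_refl)
  have "f \<in> zero_coeffs"
    using f c[of "- _" "- _"] by (simp add: zero_coeffs_def)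
  have p0: "(\<integral>z. f z * of_real (p (cis (fst z), cis (snd z))) \<partial>torus) = 0"
      "integrable torus (\<lambda>z. f z * of_real (p (cis (fst z), cis (snd z))))"
    if "real_polynomial_function p" for p
    using zero_coeffs_polynomial[OF that \<open>f \<in> zero_coeffs\<close>] torus_exp_0
      integrable_test_mult[OF f test_real_polynomial[OF that]]
    unfolding zero_coeffs_def by (auto simp: mult.commute dest!: spec[of _ 0])
  have "AE z in torus. Re (f z) = 0"
  proof (rule orthogonal_imp_zero)
    show "integrable torus (\<lambda>z. Re (f z))" using sq_integrable_integrable[OF f] by (rule integrable_Re)
    fix p :: "complex \<times> complex \<Rightarrow> real" assume "real_polynomial_function p"
    from p0[OF this] integral_Re[OF p0(2)[OF this]]
    show "(\<integral>z. Re (f z) * p (cis (fst z), cis (snd z)) \<partial>torus) = 0" by simp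
  qed
  moreover have "AE z in torus. Im (f z) = 0"
  proof (rule orthogonal_imp_zero)
    show "integrable torus (\<lambda>z. Im (f z))" using sq_integrable_integrable[OF f] by (rule integrable_Im)
    fix p :: "complex \<times> complex \<Rightarrow> real" assume "real_polynomial_function p"
    from p0[OF this] integral_Im[OF p0(2)[OF this]]
    show "(\<integral>z. Im (f z) * p (cis (fst z), cis (snd z)) \<partial>torus) = 0" by simp
  qed
  ultimately have "AE z in torus. f z = 0" by eventually_elim (simp add: complex_eq_iff)
  with f show "torus_rel f (\<lambda>_. 0)" by (simp add: torus_rel_def sq_integrable_0)
qed

section \<open>Truncated Fourier series and their convergence\<close>

definition fourier_box :: "nat \<Rightarrow> (int \<times> int) set" where
  "fourier_box N = {- int N..int N} \<times> {- int N..int N}"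

definition fourier_sum :: "nat \<Rightarrow> torus_L2 \<Rightarrow> torus_L2" where
  "fourier_sum N u = (\<Sum>(m, n)\<in>fourier_box N. fourier_coeff u m n *\<^sub>C L2_exp m n)"

lemma finite_fourier_box [simp]: "finite (fourier_box N)"
  by (simp add: fourier_box_def)

lemma fourier_box_mono: "M \<le> N \<Longrightarrow> fourier_box M \<subseteq> fourier_box N"
  by (auto simp: fourier_box_def)

lemma fourier_coeff_fourier_sum:
  "fourier_coeff (fourier_sum N u) m n = (if (m, n) \<in> fourier_box N then fourier_coeff u m n else 0)"
proof -
  have "fourier_coeff (fourier_sum N u) m n =
      (\<Sum>k\<in>fourier_box N. if k = (m, n) then fourier_coeff u m n else 0)"
    unfolding fourier_sum_def fourier_coeff_sum
    by (rule sum.cong) (auto simp: fourier_coeff_scaleC fourier_coeff_exp split: if_splits)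
  then show ?thesis by simp
qed

lemma inner_fourier_sum:
  "inner w (fourier_sum N u) =
    4 * pi\<^sup>2 * (\<Sum>(m, n)\<in>fourier_box N. Re (fourier_coeff w m n * cnj (fourier_coeff u m n)))"
  unfolding fourier_sum_def inner_sum_right
  by (simp add: case_prod_unfold inner_scaleC_L2_exp sum_distrib_left del: times_complex.sel)

text \<open>By orthogonality the squared distance of two truncations is the difference of their
  squared norms. These norms increase and are bounded by Bessel's inequality, so the truncations are
  Cauchy; their limit has the Fourier coefficients of \<open>u\<close> and hence equals
  \<open>u\<close>.\<close>

lemma fourier_sum_tendsto: "(\<lambda>N. fourier_sum N u) \<longlonglongrightarrow> u"
proof -
  let ?S = "\<lambda>N. fourier_sum N u"
  have orth: "inner (?S N) (?S M) = (norm (?S M))\<^sup>2" if "M \<le> N" for M N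
  proof -
    have "inner (?S N) (?S M) = inner (?S M) (?S M)"
      unfolding inner_fourier_sum using fourier_box_mono[OF that]
      by (intro arg_cong[where f = "\<lambda>x. _ * x"] sum.cong) (auto simp: fourier_coeff_fourier_sum)
    then show ?thesis by (simp add: power2_norm_eq_inner)
  qed
  \<comment> \<open>Together with the Cauchy-Schwarz inequality this gives Bessel's inequality after
    division by \<open>norm (?S N)\<close>.\<close>
  have "inner u (?S N) = inner (?S N) (?S N)" for N
    unfolding inner_fourier_sum
    by (intro arg_cong[where f = "\<lambda>x. _ * x"] sum.cong) (auto simp: fourier_coeff_fourier_sum)
  then have bessel: "norm (?S N) \<le> norm u" for N
    using norm_cauchy_schwarz[of u "?S N"] by (cases "norm (?S N) = 0")
      (auto simp: power2_eq_square simp flip: power2_norm_eq_inner)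
  have diff: "(norm (?S N - ?S M))\<^sup>2 = (norm (?S N))\<^sup>2 - (norm (?S M))\<^sup>2" if "M \<le> N" for M N
    using orth[OF that] by (simp add: power2_norm_eq_inner inner_diff inner_commute)
  have "convergent (\<lambda>N. (norm (?S N))\<^sup>2)"
  proof (rule Bseq_mono_convergent)
    show "Bseq (\<lambda>N. (norm (?S N))\<^sup>2)"
      by (rule BseqI'[of _ "(norm u)\<^sup>2"]) (simp add: bessel power_mono)
    have "(norm (?S M))\<^sup>2 \<le> (norm (?S N))\<^sup>2" if "M \<le> N" for M N
      using diff[OF that] zero_le_power2[of "norm (?S N - ?S M)"] by linarith
    then show "\<forall>M. \<forall>N\<ge>M. (norm (?S M))\<^sup>2 \<le> (norm (?S N))\<^sup>2" by blast
  qed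
  then have C: "Cauchy (\<lambda>N. (norm (?S N))\<^sup>2)" by (rule convergent_Cauchy)
  have "Cauchy ?S"
  proof (rule metric_CauchyI)
    fix e :: real assume "e > 0"
    then obtain K where K: "\<And>M N. M \<ge> K \<Longrightarrow> N \<ge> K \<Longrightarrow> \<bar>(norm (?S M))\<^sup>2 - (norm (?S N))\<^sup>2\<bar> < e\<^sup>2"
      using metric_CauchyD[OF C, of "e\<^sup>2"] by (auto simp: dist_real_def)
    have le: "dist (?S N) (?S M) < e" if "M \<ge> K" "M \<le> N" for M N
    proof (rule power2_less_imp_less)
      show "(dist (?S N) (?S M))\<^sup>2 < e\<^sup>2"
        using diff[OF that(2)] K[of N M] that by (simp add: dist_norm)
    qed (use \<open>e > 0\<close> in simp)
    have "dist (?S M) (?S N) < e" if "M \<ge> K" "N \<ge> K" for M N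
      using le[of M N] le[of N M] that by (cases "M \<le> N") (auto simp: dist_commute)
    then show "\<exists>K. \<forall>M\<ge>K. \<forall>N\<ge>K. dist (?S M) (?S N) < e" by blast
  qed
  then obtain p where p: "?S \<longlonglongrightarrow> p"
    using torus_L2_Cauchy_convergent unfolding convergent_def by blast
  have "fourier_coeff (u - p) m n = 0" for m n
  proof -
    let ?c = "fourier_coeff (u - p) m n"
    have "(\<lambda>N. inner (u - ?S N) (?c *\<^sub>C L2_exp m n)) \<longlonglongrightarrow> inner (u - p) (?c *\<^sub>C L2_exp m n)"
      by (intro tendsto_intros p)
    \<comment> \<open>From this index on the box contains \<open>(m, n)\<close>, so \<open>u\<close>
      and its truncation share that coefficient.\<close>
    moreover have "inner (u - ?S N) (?c *\<^sub>C L2_exp m n) = 0" if "N \<ge> nat (max \<bar>m\<bar> \<bar>n\<bar>)" for N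
      using that unfolding inner_scaleC_L2_exp
      by (auto simp: fourier_coeff_diff fourier_coeff_fourier_sum fourier_box_def)
    then have "\<forall>\<^sub>F N in sequentially. inner (u - ?S N) (?c *\<^sub>C L2_exp m n) = 0"
      unfolding eventually_sequentially by blast
    then have "(\<lambda>N. inner (u - ?S N) (?c *\<^sub>C L2_exp m n)) \<longlonglongrightarrow> 0"
      by (rule tendsto_eventually)
    ultimately have "inner (u - p) (?c *\<^sub>C L2_exp m n) = 0" by (rule LIMSEQ_unique)
    then have "Re (?c * cnj ?c) = 0" unfolding inner_scaleC_L2_exp by simp
    then show ?thesis by (simp add: complex_mult_cnj complex_eq_iff sum_power2_eq_zero_iff)
  qed
  then have "u - p = 0" by (rule fourier_coeffs_zero_imp_zero)
  with p show ?thesis by simp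
qed

lemma has_weak_deriv_fourier_sum:
  "has_weak_deriv a b (fourier_sum N u) (\<Sum>(m, n)\<in>fourier_box N.
    fourier_coeff u m n *\<^sub>C ((\<i> * of_int m) ^ a * (\<i> * of_int n) ^ b) *\<^sub>C L2_exp m n)"
proof -
  have "has_weak_deriv a b (\<Sum>i\<in>I. f i) (\<Sum>i\<in>I. g i)"
    if "\<And>i. has_weak_deriv a b (f i) (g i)" for I and f g :: "int \<times> int \<Rightarrow> torus_L2"
    by (induction I rule: infinite_finite_induct) (auto intro: has_weak_deriv_add has_weak_deriv_zero that)
  from this[OF has_weak_deriv_scaleC[OF has_weak_deriv_L2_exp]] show ?thesis
    unfolding fourier_sum_def case_prod_unfold .
qed

lemma fourier_sum_sobolev: "fourier_sum N u \<in> sobolev k"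
  unfolding sobolev_def using has_weak_deriv_fourier_sum by blast

text \<open>Both operations are diagonal in the exponentials: one multiplies coefficients, the other
  discards some of them.\<close>

lemma has_weak_deriv_fourier_sum_commute:
  assumes "has_weak_deriv a b u w"
  shows "has_weak_deriv a b (fourier_sum N u) (fourier_sum N w)"
proof -
  have "fourier_sum N w = (\<Sum>(m, n)\<in>fourier_box N.
    fourier_coeff u m n *\<^sub>C ((\<i> * of_int m) ^ a * (\<i> * of_int n) ^ b) *\<^sub>C L2_exp m n)"
    unfolding fourier_sum_def fourier_coeff_weak_deriv[OF assms]
    by (simp add: scaleC_scaleC mult.commute)
  then show ?thesis using has_weak_deriv_fourier_sum by simp
qed

text \<open>At order one the Fourier multiplier is \<i> times an integer, hence purely imaginary, so
  moving it to the other factor changes the sign. It suffices to truncate one argument of each inner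
  product and pass to the limit.\<close>

lemma inner_weak_deriv_skew:
  assumes "has_weak_deriv a b f f'" "has_weak_deriv a b g g'" "a + b = 1"
  shows "inner g f' = - inner g' f"
proof -
  have "inner g (fourier_sum N f') = - inner g' (fourier_sum N f)" for N
  proof -
    have "(a = 1 \<and> b = 0) \<or> (a = 0 \<and> b = 1)" using assms(3) by auto
    then have "Re (fourier_coeff g m n * cnj (fourier_coeff f' m n)) =
        - Re (fourier_coeff g' m n * cnj (fourier_coeff f m n))" for m n
      unfolding fourier_coeff_weak_deriv[OF assms(1)] fourier_coeff_weak_deriv[OF assms(2)]
      by (auto simp: algebra_simps)
    then show ?thesis
      unfolding inner_fourier_sum by (simp add: sum_negf case_prod_unfold del: times_complex.sel)
  qed
  moreover have "(\<lambda>N. inner g (fourier_sum N f')) \<longlonglongrightarrow> inner g f'"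
    "(\<lambda>N. - inner g' (fourier_sum N f)) \<longlonglongrightarrow> - inner g' f"
    by (intro tendsto_intros fourier_sum_tendsto)+
  ultimately show ?thesis using LIMSEQ_unique by simp
qed

section \<open>Growth of the energy\<close>

lemma C0_group_generator_derivative:
  assumes T: "C0_group T" and xy: "(x, y) \<in> generator T"
  shows "(T t x, T t y) \<in> generator T"
    and "((\<lambda>t. T t x) has_vector_derivative T t y) (at t)"
proof -
  have add: "T (s + t) z = T s (T t z)" "T s (T t z) = T t (T s z)" for s t z
    using T unfolding C0_group_def by (metis blinfun_apply_blinfun_compose add.commute)+
  \<comment> \<open>The bounded map \<open>T t\<close> preserves the limit of the difference
    quotient at zero. Since \<open>T t\<close> and \<open>T h\<close> commute, the result is the
    difference quotient of the orbit at time \<open>t\<close>.\<close>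
  have "((\<lambda>h. T t ((T h x - x) /\<^sub>R h)) \<longlongrightarrow> T t y) (at 0)"
    using xy by (intro tendsto_intros) (simp add: generator_def)
  then have lim: "((\<lambda>h. (T h (T t x) - T t x) /\<^sub>R h) \<longlongrightarrow> T t y) (at 0)"
    by (simp add: blinfun.scaleR_right blinfun.diff_right add(2)[of t])
  then show "(T t x, T t y) \<in> generator T" by (simp add: generator_def)
  have "((\<lambda>h. norm ((T h (T t x) - T t x) /\<^sub>R h - T t y)) \<longlongrightarrow> 0) (at 0)"
    using tendsto_norm[OF tendsto_diff[OF lim tendsto_const[of "T t y"]]] by simp
  moreover have "\<forall>\<^sub>F h in at 0. norm ((T h (T t x) - T t x) /\<^sub>R h - T t y) =
      norm (T (t + h) x - T t x - h *\<^sub>R T t y) / norm h"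
  proof -
    have "norm ((T h (T t x) - T t x) /\<^sub>R h - T t y) =
      norm (T (t + h) x - T t x - h *\<^sub>R T t y) / norm h" if "h \<noteq> 0" for h
    proof -
      have "(T h (T t x) - T t x) /\<^sub>R h - T t y = (T (t + h) x - T t x - h *\<^sub>R T t y) /\<^sub>R h"
        using that add(1)[of h t] by (simp add: scaleR_diff_right add.commute)
      then show ?thesis by (simp add: divide_inverse_commute)
    qed
    then show ?thesis by (simp add: eventually_at_filter)
  qed
  ultimately have "((\<lambda>h. norm (T (t + h) x - T t x - h *\<^sub>R T t y) / norm h) \<longlongrightarrow> 0) (at 0)"
    by (rule Lim_transform_eventually)
  then show "((\<lambda>t. T t x) has_vector_derivative T t y) (at t)"
    unfolding has_vector_derivative_def has_derivative_at by (simp add: bounded_linear_scaleR_left)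
qed

text \<open>For nonnegative times, \<open>exp (- s)\<close> times the function is nonincreasing.
  Negative times follow by reflection, since the two-sided bound on the derivative survives the
  change of sign.\<close>

lemma exp_growth_bound:
  fixes E :: "real \<Rightarrow> real"
  assumes E: "\<And>t. (E has_real_derivative E' t) (at t)" and bound: "\<And>t. \<bar>E' t\<bar> \<le> E t"
  shows "E t \<le> exp \<bar>t\<bar> * E 0"
proof -
  have forward: "F s \<le> exp s * F 0"
    if F: "\<And>t. (F has_real_derivative F' t) (at t)" "\<And>t. \<bar>F' t\<bar> \<le> F t" and "0 \<le> s"
    for F F' :: "real \<Rightarrow> real" and s
  proof -
    have "exp (- s) * F s \<le> exp (- 0) * F 0"
    proof (rule DERIV_nonpos_imp_nonincreasing[OF \<open>0 \<le> s\<close>])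
      fix x
      have "((\<lambda>x. exp (- x) * F x) has_real_derivative exp (- x) * (F' x - F x)) (at x)"
        by (auto intro!: derivative_eq_intros F(1) simp: algebra_simps)
      moreover have "F' x \<le> F x" using F(2)[of x] by linarith
      ultimately show "\<exists>y. ((\<lambda>x. exp (- x) * F x) has_real_derivative y) (at x) \<and> y \<le> 0"
        by (auto intro!: exI[of _ "exp (- x) * (F' x - F x)"] mult_nonneg_nonpos)
    qed
    then have "exp s * (exp (- s) * F s) \<le> exp s * F 0" by simp
    then show ?thesis by (simp add: exp_minus_inverse flip: mult.assoc)
  qed
  show ?thesis
  proof (cases "0 \<le> t")
    case True
    then show ?thesis using forward[OF E bound True] by simp
  next
    case False
    have "((\<lambda>s. E (- s)) has_real_derivative - E' (- s)) (at s)" for s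
      using DERIV_chain2[where f = E and g = uminus, OF E DERIV_minus[OF DERIV_ident]] by simp
    from forward[of "\<lambda>s. E (- s)" _ "- t", OF this] bound False show ?thesis by simp
  qed
qed

section \<open>The multiplication operator and repeated weak derivatives\<close>

lemma norm_mult_M: "norm (mult_M h) = norm h"
  by transfer (simp add: case_prod_unfold norm_mult)

text \<open>Use \<open>partial_x \<phi>\<close> as a test function in the definition of
  \<open>u1\<close> and compare with the definition of \<open>u2\<close>.\<close>

lemma has_weak_deriv_weak_deriv_x:
  assumes "has_weak_deriv 1 0 u u1" "has_weak_deriv 2 0 u u2" shows "has_weak_deriv 1 0 u1 u2"
  using assms
proof transfer
  fix u u1 u2
  assume u1: "\<forall>\<phi>\<in>torus_test. (\<integral>z. u z * (partial_x ^^ 1) ((partial_y ^^ 0) \<phi>) z \<partial>torus) =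
       (- 1) ^ (1 + 0) * (\<integral>z. u1 z * \<phi> z \<partial>torus)"
    and u2: "\<forall>\<phi>\<in>torus_test. (\<integral>z. u z * (partial_x ^^ 2) ((partial_y ^^ 0) \<phi>) z \<partial>torus) =
       (- 1) ^ (2 + 0) * (\<integral>z. u2 z * \<phi> z \<partial>torus)"
  show "\<forall>\<phi>\<in>torus_test. (\<integral>z. u1 z * (partial_x ^^ 1) ((partial_y ^^ 0) \<phi>) z \<partial>torus) =
       (- 1) ^ (1 + 0) * (\<integral>z. u2 z * \<phi> z \<partial>torus)"
    using u1[rule_format, OF test_dx_dy(1)] u2[rule_format]
    by (simp add: numeral_2_eq_2) (metis minus_equation_iff)
qed

lemma has_weak_deriv_weak_deriv_y:
  assumes "has_weak_deriv 0 1 u u1" "has_weak_deriv 0 2 u u2" shows "has_weak_deriv 0 1 u1 u2"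
  using assms
proof transfer
  fix u u1 u2
  assume u1: "\<forall>\<phi>\<in>torus_test. (\<integral>z. u z * (partial_x ^^ 0) ((partial_y ^^ 1) \<phi>) z \<partial>torus) =
       (- 1) ^ (0 + 1) * (\<integral>z. u1 z * \<phi> z \<partial>torus)"
    and u2: "\<forall>\<phi>\<in>torus_test. (\<integral>z. u z * (partial_x ^^ 0) ((partial_y ^^ 2) \<phi>) z \<partial>torus) =
       (- 1) ^ (0 + 2) * (\<integral>z. u2 z * \<phi> z \<partial>torus)"
  show "\<forall>\<phi>\<in>torus_test. (\<integral>z. u1 z * (partial_x ^^ 0) ((partial_y ^^ 1) \<phi>) z \<partial>torus) =
       (- 1) ^ (0 + 1) * (\<integral>z. u2 z * \<phi> z \<partial>torus)"
    using u1[rule_format, OF test_dx_dy(2)] u2[rule_format]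
    by (simp add: numeral_2_eq_2) (metis minus_equation_iff)
qed

section \<open>The Sobolev norm, the energy and the domain of the generator\<close>

definition W1_deriv :: "nat \<Rightarrow> nat \<Rightarrow> torus_W1 \<Rightarrow> torus_L2" where
  "W1_deriv a b u = weak_deriv a b (W1_to_L2 u)"

lemma has_weak_deriv_W1_deriv: "a + b \<le> 1 \<Longrightarrow> has_weak_deriv a b (W1_to_L2 u) (W1_deriv a b u)"
  unfolding W1_deriv_def using W1_to_L2 by (rule has_weak_deriv_weak_deriv)

lemma W1_deriv_0 [simp]: "W1_deriv 0 0 u = W1_to_L2 u"
  unfolding W1_deriv_def by (rule weak_deriv_eqI[OF has_weak_deriv_0])

lemma norm_torus_W1:
  "(norm u)\<^sup>2 = (norm (W1_to_L2 u))\<^sup>2 + (norm (W1_deriv 1 0 u))\<^sup>2 + (norm (W1_deriv 0 1 u))\<^sup>2"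
proof -
  have "{(a, b). a + b \<le> Suc 0} = {(0, 0), (1, 0), (0, 1)}" by auto
  then have "(norm u)\<^sup>2 = (norm (W1_deriv 0 0 u))\<^sup>2 + (norm (W1_deriv 1 0 u))\<^sup>2 + (norm (W1_deriv 0 1 u))\<^sup>2"
    by (simp add: norm_torus_W1.rep_eq sobolev_norm_def W1_deriv_def add.assoc)
  then show ?thesis by simp
qed

text \<open>The square of each derivative's norm is one of the three summands of the squared Sobolev
  norm. Boundedness allows these derivatives to be differentiated in time along an orbit.\<close>

lemma bounded_linear_W1_deriv:
  assumes "a + b \<le> 1" shows "bounded_linear (W1_deriv a b)"
proof (rule bounded_linear_intro)
  show "W1_deriv a b (u + w) = W1_deriv a b u + W1_deriv a b w" for u w
    unfolding W1_deriv_def plus_torus_W1.rep_eq using W1_to_L2 W1_to_L2 assms by (rule weak_deriv_add)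
  show "W1_deriv a b (r *\<^sub>R u) = r *\<^sub>R W1_deriv a b u" for r u
    unfolding W1_deriv_def scaleR_torus_W1.rep_eq using W1_to_L2 assms by (rule weak_deriv_scaleR)
  have "(a = 0 \<and> b = 0) \<or> (a = 1 \<and> b = 0) \<or> (a = 0 \<and> b = 1)" using assms by auto
  then have "(norm (W1_deriv a b u))\<^sup>2 \<le> (norm u)\<^sup>2" for u
    using norm_torus_W1[of u] by auto
  then show "norm (W1_deriv a b u) \<le> norm u * 1" for u
    by (simp add: power2_le_imp_le[OF _ norm_ge_zero])
qed

lemma bounded_linear_W1_to_L2: "bounded_linear W1_to_L2"
  using bounded_linear_W1_deriv[of 0 0] by (simp add: W1_deriv_0[abs_def])

text \<open>This controls only part of the squared norm: the \<open>L^2\<close> norm of the first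
  component is missing and is estimated separately in \<open>orbit_bound\<close>.\<close>

definition energy :: "torus_H \<Rightarrow> real" where
  "energy z = (norm (W1_deriv 1 0 (fst z)))\<^sup>2 + (norm (W1_deriv 0 1 (fst z)))\<^sup>2 + (norm (snd z))\<^sup>2"

lemma energy_nonneg: "0 \<le> energy z"
  by (simp add: energy_def)

lemma norm_torus_H: "(norm z)\<^sup>2 = (norm (W1_to_L2 (fst z)))\<^sup>2 + energy z" for z :: torus_H
  by (simp add: norm_prod_def norm_torus_W1 energy_def)

text \<open>This is the component \<open>u' = v\<close> of the evolution equation; membership in
  \<open>dom_A\<close> ensures that \<open>Abs_W1\<close> is applied inside the Sobolev
  space.\<close>

lemma W1_to_L2_op_A: "z \<in> dom_A \<Longrightarrow> W1_to_L2 (fst (- op_A z)) = snd z"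
  by (auto simp: dom_A_def op_A_def Abs_W1_inverse)

text \<open>The terms with second derivatives cancel after integration by parts.\<close>

lemma energy_derivative_identity:
  assumes "z \<in> dom_A"
  shows "inner (W1_deriv 1 0 (fst z)) (W1_deriv 1 0 (fst (- op_A z))) +
      inner (W1_deriv 0 1 (fst z)) (W1_deriv 0 1 (fst (- op_A z))) +
      inner (snd z) (snd (- op_A z)) = inner (snd z) (mult_M (W1_deriv 1 0 (fst z)))"
proof -
  obtain u v where z: "z = (u, v)" by fastforce
  let ?U = "W1_to_L2 u" and ?w = "fst (- op_A z)"
  have U: "?U \<in> sobolev 2" using assms by (simp add: dom_A_def z)
  have w: "W1_to_L2 ?w = v" using W1_to_L2_op_A[OF assms] by (simp add: z)
  have "has_weak_deriv 1 0 (W1_deriv 1 0 u) (weak_deriv 2 0 ?U)"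
    by (rule has_weak_deriv_weak_deriv_x[OF has_weak_deriv_W1_deriv has_weak_deriv_weak_deriv[OF U]]) simp_all
  moreover have "has_weak_deriv 0 1 (W1_deriv 0 1 u) (weak_deriv 0 2 ?U)"
    by (rule has_weak_deriv_weak_deriv_y[OF has_weak_deriv_W1_deriv has_weak_deriv_weak_deriv[OF U]]) simp_all
  moreover have "has_weak_deriv 1 0 v (W1_deriv 1 0 ?w)" "has_weak_deriv 0 1 v (W1_deriv 0 1 ?w)"
    using has_weak_deriv_W1_deriv[of _ _ ?w] w by auto
  ultimately have "inner v (weak_deriv 2 0 ?U) = - inner (W1_deriv 1 0 ?w) (W1_deriv 1 0 u)"
    "inner v (weak_deriv 0 2 ?U) = - inner (W1_deriv 0 1 ?w) (W1_deriv 0 1 u)"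
    using inner_weak_deriv_skew by auto
  moreover have "snd (- op_A z) = weak_deriv 2 0 ?U + weak_deriv 0 2 ?U + mult_M (W1_deriv 1 0 u)"
    by (simp add: z op_A_def laplacian_def W1_deriv_def)
  ultimately show ?thesis
    by (simp add: z inner_add_right inner_commute)
qed

text \<open>Truncate the Fourier series of both components. Since truncation commutes with
  first-order weak derivatives, the first component also converges in the Sobolev norm.\<close>

lemma dom_A_dense:
  fixes z :: torus_H
  obtains s where "\<And>N. s N \<in> dom_A" "s \<longlonglongrightarrow> z"
proof -
  obtain u v where z: "z = (u, v)" by fastforce
  define p where "p N = Abs_W1 (fourier_sum N (W1_to_L2 u))" for N
  have p: "W1_to_L2 (p N) = fourier_sum N (W1_to_L2 u)" for N
    by (simp add: p_def Abs_W1_inverse fourier_sum_sobolev)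
  have "W1_deriv a b (p N) = fourier_sum N (W1_deriv a b u)" if "a + b \<le> 1" for a b N
    unfolding W1_deriv_def[of a b "p N"] p
    by (rule weak_deriv_eqI[OF has_weak_deriv_fourier_sum_commute[OF has_weak_deriv_W1_deriv[OF that]]])
  then have D: "(\<lambda>N. W1_deriv a b (p N - u)) \<longlonglongrightarrow> 0" if "a + b \<le> 1" for a b
    using tendsto_diff[OF fourier_sum_tendsto[of "W1_deriv a b u"] tendsto_const[of "W1_deriv a b u"]] that
    by (simp add: bounded_linear.linear[OF bounded_linear_W1_deriv, THEN linear_diff])
  have "(\<lambda>N. (norm (W1_deriv 0 0 (p N - u)))\<^sup>2 + (norm (W1_deriv 1 0 (p N - u)))\<^sup>2 +
      (norm (W1_deriv 0 1 (p N - u)))\<^sup>2) \<longlonglongrightarrow> (norm (0::torus_L2))\<^sup>2 + (norm (0::torus_L2))\<^sup>2 + (norm (0::torus_L2))\<^sup>2"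
    by (intro tendsto_intros D) simp_all
  then have "(\<lambda>N. sqrt ((norm (p N - u))\<^sup>2)) \<longlonglongrightarrow> sqrt 0"
    by (intro tendsto_intros) (simp add: norm_torus_W1)
  then have "p \<longlonglongrightarrow> u"
    by (simp add: tendsto_norm_zero_iff LIM_zero_iff)
  then have "(\<lambda>N. (p N, fourier_sum N v)) \<longlonglongrightarrow> z"
    unfolding z by (intro tendsto_Pair fourier_sum_tendsto)
  moreover have "(p N, fourier_sum N v) \<in> dom_A" for N
    by (simp add: dom_A_def p fourier_sum_sobolev)
  ultimately show ?thesis by (rule that[rotated])
qed

section \<open>Orbits of the group and the norm estimate\<close>

locale wave_group =
  fixes T :: "real \<Rightarrow> torus_H \<Rightarrow>\<^sub>L torus_H"
  assumes group: "C0_group T" and gen: "generator T = {(x, - op_A x) | x. x \<in> dom_A}"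
begin

text \<open>The pair \<open>(T t z, T t (- op_A z))\<close> lies in the graph of the generator.
  Reading that graph as the one of \<open>- op_A\<close> gives both the invariance of the domain and
  the value of the derivative.\<close>

lemma orbit:
  assumes "z \<in> dom_A"
  shows "T t z \<in> dom_A" "((\<lambda>t. T t z) has_vector_derivative - op_A (T t z)) (at t)"
proof -
  have "(z, - op_A z) \<in> generator T" using assms unfolding gen by blast
  note d = C0_group_generator_derivative[OF group this, of t]
  show "T t z \<in> dom_A" "((\<lambda>t. T t z) has_vector_derivative - op_A (T t z)) (at t)"
    using d unfolding gen by auto
qed

lemma orbit_component_derivative:
  assumes "z \<in> dom_A"
  shows "((\<lambda>t. snd (T t z)) has_vector_derivative snd (- op_A (T t z))) (at t)"
    and "bounded_linear D \<Longrightarrow>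
      ((\<lambda>t. D (fst (T t z))) has_vector_derivative D (fst (- op_A (T t z)))) (at t)"
  using bounded_linear.has_vector_derivative[OF bounded_linear_snd orbit(2)[OF assms]]
    bounded_linear.has_vector_derivative[OF bounded_linear_compose[OF _ bounded_linear_fst] orbit(2)[OF assms]]
  by auto

lemma energy_growth:
  assumes z: "z \<in> dom_A"
  shows "energy (T t z) \<le> exp \<bar>t\<bar> * energy z"
proof -
  let ?z = "\<lambda>t. T t z"
  let ?E' = "\<lambda>t. 2 * inner (snd (?z t)) (mult_M (W1_deriv 1 0 (fst (?z t))))"
  have sq: "((\<lambda>t. (norm (f t))\<^sup>2) has_real_derivative 2 * inner (f t) f') (at t)"
    if "(f has_vector_derivative f') (at t)" for f :: "real \<Rightarrow> torus_L2" and f' t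
  proof -
    have "((\<lambda>t. inner (f t) (f t)) has_derivative (\<lambda>h. inner (f t) (h *\<^sub>R f') + inner (h *\<^sub>R f') (f t))) (at t)"
      using that unfolding has_vector_derivative_def by (intro has_derivative_inner)
    then show ?thesis
      unfolding has_field_derivative_def power2_norm_eq_inner
      by (rule has_derivative_eq_rhs) (simp add: fun_eq_iff inner_commute)
  qed
  have "((\<lambda>t. energy (?z t)) has_real_derivative ?E' t) (at t)" for t
  proof -
    have "((\<lambda>t. energy (?z t)) has_real_derivative
        2 * inner (W1_deriv 1 0 (fst (?z t))) (W1_deriv 1 0 (fst (- op_A (?z t)))) +
        2 * inner (W1_deriv 0 1 (fst (?z t))) (W1_deriv 0 1 (fst (- op_A (?z t)))) +
        2 * inner (snd (?z t)) (snd (- op_A (?z t)))) (at t)"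
      unfolding energy_def
      by (intro DERIV_add sq orbit_component_derivative[OF z] bounded_linear_W1_deriv) simp_all
    then show ?thesis
      by (rule DERIV_cong) (use energy_derivative_identity[OF orbit(1)[OF z, of t]] in linarith)
  qed
  moreover have "\<bar>?E' t\<bar> \<le> energy (?z t)" for t
  proof -
    let ?v = "snd (?z t)" and ?ux = "W1_deriv 1 0 (fst (?z t))"
    have "\<bar>?E' t\<bar> \<le> 2 * (norm ?v * norm ?ux)"
      using Cauchy_Schwarz_ineq2[of ?v "mult_M ?ux"] by (simp add: norm_mult_M abs_mult)
    also have "\<dots> \<le> (norm ?v)\<^sup>2 + (norm ?ux)\<^sup>2"
      using sum_squares_bound[of "norm ?v" "norm ?ux"] by simp
    also have "\<dots> \<le> energy (?z t)" by (simp add: energy_def)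
    finally show ?thesis .
  qed
  ultimately have "energy (?z t) \<le> exp \<bar>t\<bar> * energy (?z 0)"
    by (rule exp_growth_bound)
  then show ?thesis using group by (simp add: C0_group_def)
qed

text \<open>The constant is 1 + 2 + 1: the initial value of the first component, the integral of
  \<open>exp (s / 2)\<close> that bounds its change, and the square root of the energy.\<close>

lemma orbit_bound:
  assumes z: "z \<in> dom_A"
  shows "norm (T t z) \<le> 4 * exp (\<bar>t\<bar> / 2) * norm z"
proof -
  have T0: "T 0 = id_blinfun" using group by (simp add: C0_group_def)
  define S where "S = sqrt (energy z)"
  define U where "U t = W1_to_L2 (fst (T t z))" for t
  have S: "S \<ge> 0" by (simp add: S_def energy_nonneg)
  have sqrt_energy: "sqrt (energy (T t z)) \<le> exp (\<bar>t\<bar> / 2) * S" for t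
  proof -
    have "sqrt (energy (T t z)) \<le> sqrt (exp \<bar>t\<bar> * energy z)"
      by (intro real_sqrt_le_mono energy_growth z)
    also have "exp \<bar>t\<bar> = (exp (\<bar>t\<bar> / 2))\<^sup>2" by (simp flip: exp_double)
    finally show ?thesis by (simp add: S_def real_sqrt_mult)
  qed
  have v: "norm (snd (T t z)) \<le> exp (\<bar>t\<bar> / 2) * S" for t
  proof -
    have "norm (snd (T t z)) = sqrt ((norm (snd (T t z)))\<^sup>2)" by simp
    also have "\<dots> \<le> sqrt (energy (T t z))"
      by (intro real_sqrt_le_mono) (simp add: energy_def)
    finally show ?thesis using sqrt_energy[of t] by linarith
  qed
  have dU: "(U has_vector_derivative snd (T t z)) (at t)" for t
    using orbit_component_derivative(2)[OF z bounded_linear_W1_to_L2, of t]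
      W1_to_L2_op_A[OF orbit(1)[OF z, of t]]
    unfolding U_def by simp
  \<comment> \<open>The sign \<open>c\<close> treats both time directions at once. The bounding
    function is an antiderivative of the speed bound \<open>exp (s / 2) * S\<close>.\<close>
  have shift: "norm (U (c * s) - U (c * 0)) \<le> 2 * exp (s / 2) * S - 2 * exp (0 / 2) * S"
    if c: "\<bar>c\<bar> = 1" and "0 < s" for c s
  proof (rule differentiable_bound_general[OF \<open>0 < s\<close>])
    have d: "((\<lambda>s. U (c * s)) has_vector_derivative c *\<^sub>R snd (T (c * x) z)) (at x)" for x
    proof -
      have "((\<lambda>s. c * s) has_real_derivative c) (at x)" by (auto intro!: derivative_eq_intros)
      from vector_diff_chain_at[OF this[unfolded has_real_derivative_iff_has_vector_derivative] dU]
      show ?thesis by (simp add: o_def)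
    qed
    then show "((\<lambda>s. U (c * s)) has_vector_derivative c *\<^sub>R snd (T (c * x) z)) (at x)" for x .
    show "continuous_on {0..s} (\<lambda>s. U (c * s))"
      using d has_vector_derivative_continuous continuous_at_imp_continuous_on by blast
    show "continuous_on {0..s} (\<lambda>s. 2 * exp (s / 2) * S)" by (intro continuous_intros) auto
    show "((\<lambda>s. 2 * exp (s / 2) * S) has_vector_derivative exp (x / 2) * S) (at x)" for x
      unfolding has_real_derivative_iff_has_vector_derivative[symmetric]
      by (auto intro!: derivative_eq_intros)
    show "norm (c *\<^sub>R snd (T (c * x) z)) \<le> exp (x / 2) * S" if "0 < x" for x
      using v[of "c * x"] c that by (simp add: abs_mult)
  qed
  have U: "norm (U t) \<le> norm (U 0) + 2 * exp (\<bar>t\<bar> / 2) * S"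
  proof (cases "t = 0")
    case True
    then show ?thesis using S by simp
  next
    case False
    then have "norm (U t - U 0) \<le> 2 * exp (\<bar>t\<bar> / 2) * S - 2 * S"
      using shift[of "sgn t" "\<bar>t\<bar>"] by (simp add: abs_sgn_eq sgn_mult_abs)
    then show ?thesis using S norm_triangle_sub[of "U t" "U 0"] by linarith
  qed
  have "(norm (U 0))\<^sup>2 \<le> (norm z)\<^sup>2" "S\<^sup>2 \<le> (norm z)\<^sup>2"
    using norm_torus_H[of z] by (simp_all add: U_def S_def T0 energy_nonneg)
  then have le: "norm (U 0) \<le> norm z" "S \<le> norm z" by (auto intro: power2_le_imp_le[OF _ norm_ge_zero])
  have "(norm (T t z))\<^sup>2 = (norm (U t))\<^sup>2 + (sqrt (energy (T t z)))\<^sup>2"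
    using norm_torus_H[of "T t z"] energy_nonneg[of "T t z"] by (simp add: U_def)
  then have "norm (T t z) = sqrt ((norm (U t))\<^sup>2 + (sqrt (energy (T t z)))\<^sup>2)"
    by (simp only: real_sqrt_abs abs_norm_cancel flip: \<open>_ = (norm (U t))\<^sup>2 + _\<close>)
  also have "\<dots> \<le> norm (U t) + sqrt (energy (T t z))"
    by (rule sqrt_sum_squares_le_sum) (simp_all add: energy_nonneg)
  also have "\<dots> \<le> norm (U 0) + 3 * exp (\<bar>t\<bar> / 2) * S"
    using U sqrt_energy[of t] by linarith
  also have "\<dots> \<le> exp (\<bar>t\<bar> / 2) * norm z + 3 * exp (\<bar>t\<bar> / 2) * norm z"
    using le mult_right_mono[of 1 "exp (\<bar>t\<bar> / 2)" "norm z"]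
    by (intro add_mono mult_left_mono) auto
  finally show ?thesis by (simp add: algebra_simps)
qed

text \<open>Both sides of the orbit estimate are continuous in \<open>z\<close>, so it extends from
  the dense domain to the whole space.\<close>

lemma norm_bound: "norm (T t) \<le> 4 * exp (\<bar>t\<bar> / 2)"
proof (rule norm_blinfun_bound)
  fix z :: torus_H
  obtain s where s: "\<And>N. s N \<in> dom_A" "s \<longlonglongrightarrow> z"
    using dom_A_dense by blast
  show "norm (T t z) \<le> 4 * exp (\<bar>t\<bar> / 2) * norm z"
  proof (rule LIMSEQ_le)
    show "(\<lambda>N. norm (T t (s N))) \<longlonglongrightarrow> norm (T t z)"
      "(\<lambda>N. 4 * exp (\<bar>t\<bar> / 2) * norm (s N)) \<longlonglongrightarrow> 4 * exp (\<bar>t\<bar> / 2) * norm z"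
      by (intro tendsto_intros s(2))+
  qed (use orbit_bound[OF s(1)] in blast)
qed simp

end

theorem proposition5:
  fixes T :: "real \<Rightarrow> torus_H \<Rightarrow>\<^sub>L torus_H"
  assumes "C0_group T"
    and "generator T = {(x, - op_A x) | x. x \<in> dom_A}"
  shows "(\<lambda>t. norm (T t)) \<in> O[at_top](\<lambda>t. \<bar>t\<bar> / sqrt (ln \<bar>t\<bar>) * exp (\<bar>t\<bar> / 2)) \<and>
    (\<lambda>t. norm (T t)) \<in> O[at_bot](\<lambda>t. \<bar>t\<bar> / sqrt (ln \<bar>t\<bar>) * exp (\<bar>t\<bar> / 2))"
proof -
  interpret wave_group T using assms by (rule wave_group.intro)
  \<comment> \<open>For such \<open>t\<close> the logarithm is positive and below
    \<open>\<bar>t\<bar>\<^sup>2\<close>, so the extra factor is at least one and the constant 4 of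
    \<open>norm_bound\<close> is kept.\<close>
  have bound: "norm (norm (T t)) \<le> 4 * norm (\<bar>t\<bar> / sqrt (ln \<bar>t\<bar>) * exp (\<bar>t\<bar> / 2))" if "\<bar>t\<bar> > 1" for t
  proof -
    have "\<bar>t\<bar> \<le> \<bar>t\<bar>\<^sup>2" using that by (intro self_le_power) auto
    moreover have "ln \<bar>t\<bar> < \<bar>t\<bar>" using that by (intro ln_less_self) auto
    ultimately have "ln \<bar>t\<bar> \<le> \<bar>t\<bar>\<^sup>2" by linarith
    moreover have "0 < ln \<bar>t\<bar>" using that by simp
    ultimately have "1 \<le> \<bar>t\<bar> / sqrt (ln \<bar>t\<bar>)"
      by (simp add: real_le_lsqrt)
    from mult_right_mono[OF this, of "exp (\<bar>t\<bar> / 2)"]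
    have "norm (T t) \<le> 4 * (\<bar>t\<bar> / sqrt (ln \<bar>t\<bar>) * exp (\<bar>t\<bar> / 2))"
      using norm_bound[of t] by simp
    also have "\<dots> \<le> 4 * norm (\<bar>t\<bar> / sqrt (ln \<bar>t\<bar>) * exp (\<bar>t\<bar> / 2))"
      unfolding real_norm_def by (rule mult_left_mono[OF abs_ge_self]) simp
    finally show ?thesis by simp
  qed
  show ?thesis
  proof
    show "(\<lambda>t. norm (T t)) \<in> O[at_top](\<lambda>t. \<bar>t\<bar> / sqrt (ln \<bar>t\<bar>) * exp (\<bar>t\<bar> / 2))"
      by (rule bigoI[of _ 4], rule eventually_mono[OF eventually_gt_at_top[of 1]], rule bound) auto
    show "(\<lambda>t. norm (T t)) \<in> O[at_bot](\<lambda>t. \<bar>t\<bar> / sqrt (ln \<bar>t\<bar>) * exp (\<bar>t\<bar> / 2))"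
      by (rule bigoI[of _ 4], rule eventually_mono[OF eventually_gt_at_bot[of "- 1"]], rule bound) auto
  qed
qed

end
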